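(* There exists a weight $\omega$ on $\mathbb{Z}$ such that $\operatorname{rad}(\ell^1(\mathbb{Z},\omega)'')$ contains non-nilpotent elements, where $\ell^1(\mathbb{Z},\omega)''$ carries the first Arens product $\Box$.
   Context: A weight on $\mathbb{Z}$ is a function $\omega:\mathbb{Z}\to[1,\infty)$ with $\omega(0)=1$ and $\omega(m+n)\le\omega(m)\omega(n)$ for all $m,n\in\mathbb{Z}$. $\ell^1(\mathbb{Z},\omega)=\{f:\mathbb{Z}\to\mathbb{C}:\|f\|_\omega:=\sum_{n}|f(n)|\omega(n)<\infty\}$, a unital Banach algebra under convolution. For a Banach algebra $A$ with dual $A'$ and bidual $A''$, the first Arens product $\Box$ on $A''$ is defined by $\langle\Psi\Box\Phi,\lambda\rangle=\langle\Psi,\Phi\cdot\lambda\rangle$, $\langle\Phi\cdot\lambda,a\rangle=\langle\Phi,\lambda\cdot a\rangle$, $\langle\lambda\cdot a,b\rangle=\langle\lambda,ab\rangle$ for $\Phi,\Psi\in A''$, $\lambda\in A'$, $a,b\in A$; it makes $A''$ a Banach algebra extending $A$. For a unital Banach algebra $B$, $\operatorname{rad}(B)$ denotes the Jacobson radical: $\operatorname{rad}(B)=\{a\in B: ba\text{ is quasi-nilpotent for every }b\in B\}$, where $a$ is quasi-nilpotent if $\lim_n\|a^n\|^{1/n}=0$. An element $a$ is nilpotent if $a^n=0$ for some $n\in\mathbb{N}=\{1,2,\ldots\}$. *)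

theory Defs
  imports "HOL-Analysis.Infinite_Sum" "HOL-Algebra.Module"
begin

text \<open>The space \<open>\<ell>\<^sup>1(\<int>, \<omega>)\<close> depends on the weight, which varies within a single statement, so complex
  normed spaces are carrier-based.  Functionals are extensional functions on the carrier,
  so equality of functionals is equality on the space.\<close>

record 'a normed_space = "'a partial_object" +
  vadd :: "'a \<Rightarrow> 'a \<Rightarrow> 'a"
  vscale :: "complex \<Rightarrow> 'a \<Rightarrow> 'a"
  vnorm :: "'a \<Rightarrow> real"

definition bounded_functionals :: "'a normed_space \<Rightarrow> ('a \<Rightarrow> complex) set" where
  "bounded_functionals V =
    {\<phi> \<in> extensional (carrier V).
      (\<forall>x \<in> carrier V. \<forall>y \<in> carrier V. \<phi> (vadd V x y) = \<phi> x + \<phi> y) \<and>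
      (\<forall>c. \<forall>x \<in> carrier V. \<phi> (vscale V c x) = c * \<phi> x) \<and>
      (\<exists>C. \<forall>x \<in> carrier V. cmod (\<phi> x) \<le> C * vnorm V x)}"

definition dual :: "'a normed_space \<Rightarrow> ('a \<Rightarrow> complex) normed_space" where
  "dual V =
    \<lparr>carrier = bounded_functionals V,
     vadd = (\<lambda>\<phi> \<psi>. \<lambda>x \<in> carrier V. \<phi> x + \<psi> x),
     vscale = (\<lambda>c \<phi>. \<lambda>x \<in> carrier V. c * \<phi> x),
     vnorm = (\<lambda>\<phi>. SUP x \<in> {x \<in> carrier V. vnorm V x \<le> 1}. cmod (\<phi> x))\<rparr>"

record 'a normed_algebra = "(complex, 'a) module" +
  nrm :: "'a \<Rightarrow> real"

definition vector_space_of :: "'a normed_algebra \<Rightarrow> 'a normed_space" where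
  "vector_space_of A = \<lparr>carrier = carrier A, vadd = add A, vscale = smult A, vnorm = nrm A\<rparr>"

text \<open>The term at \<open>n = 0\<close> is \<open>root 0 _ = 0\<close> and does not affect the limit.\<close>

definition quasi_nilpotent :: "'a normed_algebra \<Rightarrow> 'a \<Rightarrow> bool" where
  "quasi_nilpotent B a \<longleftrightarrow> (\<lambda>n. root n (nrm B (a [^]\<^bsub>B\<^esub> n))) \<longlonglongrightarrow> 0"

definition nilpotent :: "'a normed_algebra \<Rightarrow> 'a \<Rightarrow> bool" where
  "nilpotent B a \<longleftrightarrow> (\<exists>n::nat. n \<ge> 1 \<and> a [^]\<^bsub>B\<^esub> n = \<zero>\<^bsub>B\<^esub>)"

definition jacobson_radical :: "'a normed_algebra \<Rightarrow> 'a set" where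
  "jacobson_radical B =
    {a \<in> carrier B. \<forall>b \<in> carrier B. quasi_nilpotent B (b \<otimes>\<^bsub>B\<^esub> a)}"

abbreviation dual_of :: "'a normed_algebra \<Rightarrow> ('a \<Rightarrow> complex) normed_space" where
  "dual_of A \<equiv> dual (vector_space_of A)"

abbreviation bidual_of :: "'a normed_algebra \<Rightarrow> (('a \<Rightarrow> complex) \<Rightarrow> complex) normed_space" where
  "bidual_of A \<equiv> dual (dual_of A)"

text \<open>The module actions \<open>\<lambda> \<cdot> a\<close> (\<open>functional_act A \<lambda> a\<close>) and \<open>\<Phi> \<cdot> \<lambda>\<close> (\<open>bidual_act A \<Phi> \<lambda>\<close>) used for the
  first Arens product \<open>\<langle>\<Psi> \<box> \<Phi>, \<lambda>\<rangle> = \<langle>\<Psi>, \<Phi> \<cdot> \<lambda>\<rangle>\<close>.\<close>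

definition functional_act :: "'a normed_algebra \<Rightarrow> ('a \<Rightarrow> complex) \<Rightarrow> 'a \<Rightarrow> 'a \<Rightarrow> complex" where
  "functional_act A l a = (\<lambda>b \<in> carrier A. l (a \<otimes>\<^bsub>A\<^esub> b))"

definition bidual_act ::
  "'a normed_algebra \<Rightarrow> (('a \<Rightarrow> complex) \<Rightarrow> complex) \<Rightarrow> ('a \<Rightarrow> complex) \<Rightarrow> 'a \<Rightarrow> complex" where
  "bidual_act A \<Phi> l = (\<lambda>a \<in> carrier A. \<Phi> (functional_act A l a))"

definition arens_product ::
  "'a normed_algebra \<Rightarrow> (('a \<Rightarrow> complex) \<Rightarrow> complex) \<Rightarrow> (('a \<Rightarrow> complex) \<Rightarrow> complex)
    \<Rightarrow> ('a \<Rightarrow> complex) \<Rightarrow> complex" where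
  "arens_product A \<Psi> \<Phi> = (\<lambda>l \<in> carrier (dual_of A). \<Psi> (bidual_act A \<Phi> l))"

text \<open>The identity of the bidual is the canonical image of the identity of \<open>A\<close>.\<close>

definition bidual_algebra :: "'a normed_algebra \<Rightarrow> (('a \<Rightarrow> complex) \<Rightarrow> complex) normed_algebra" where
  "bidual_algebra A =
    \<lparr>carrier = carrier (bidual_of A),
     mult = arens_product A,
     one = (\<lambda>l \<in> carrier (dual_of A). l \<one>\<^bsub>A\<^esub>),
     zero = (\<lambda>l \<in> carrier (dual_of A). 0),
     add = vadd (bidual_of A),
     smult = vscale (bidual_of A),
     nrm = vnorm (bidual_of A)\<rparr>"

definition weight :: "(int \<Rightarrow> real) \<Rightarrow> bool" where
  "weight \<omega> \<longleftrightarrow> (\<forall>n. \<omega> n \<ge> 1) \<and> \<omega> 0 = 1 \<and> (\<forall>m n. \<omega> (m + n) \<le> \<omega> m * \<omega> n)"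

definition beurling :: "(int \<Rightarrow> real) \<Rightarrow> (int \<Rightarrow> complex) normed_algebra" where
  "beurling \<omega> =
    \<lparr>carrier = {f. (\<lambda>n. cmod (f n) * \<omega> n) summable_on UNIV},
     mult = (\<lambda>f g n. \<Sum>\<^sub>\<infinity>k\<in>UNIV. f k * g (n - k)),
     one = (\<lambda>n. if n = 0 then 1 else 0),
     zero = (\<lambda>n. 0),
     add = (\<lambda>f g n. f n + g n),
     smult = (\<lambda>c f n. c * f n),
     nrm = (\<lambda>f. \<Sum>\<^sub>\<infinity>n\<in>UNIV. cmod (f n) * \<omega> n)\<rparr>"

end

theory Submission
  imports Defs "HOL-Analysis.Function_Topology" "HOL-Analysis.Topology_Euclidean_Space"
begin

text \<open>The non-nilpotent radical element is a limit point of scaled point masses whose powers decay faster than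
any geometric sequence, even after multiplication by other elements of the bidual, and yet never vanish.

\<^bold>\<open>The weight.\<close> Let \<open>g\<^sub>i = (i!)\<^sup>4\<close>. These integers grow so fast that they behave like free generators
of a free abelian group. Charge a combination \<open>n = \<Sum> x\<^sub>i g\<^sub>i\<close> the cost
\<open>\<Sum> i \<bar>x\<^sub>i\<bar> + \<Sum>\<^sub>s min s (N\<^sub>s x)\<close> with \<open>N\<^sub>s x = \<Sum>\<^sub>i\<^sub>\<ge>\<^sub>s \<bar>x\<^sub>i\<bar>\<close>, let \<open>len n\<close> be the least cost of a combination
representing \<open>n\<close>, and take the weight \<open>2 ^ len n\<close>. Every term of the cost is subadditive, so this is a
weight. A single \<open>g\<^sub>i\<close> costs at most \<open>2 i\<close>. In a sum of \<open>k\<close> generators with indices \<open>j\<^sub>1, \<dots>, j\<^sub>k\<close> that are at least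
\<open>k\<close>, the cap at level \<open>s \<le> k\<close> discards \<open>k - s\<close> units, so the sum has length at most
\<open>2 (j\<^sub>1 + \<dots> + j\<^sub>k) - k (k - 1) / 2\<close> (\<open>len_sum_gen_le\<close>). If the indices are distinct, the length is at least
\<open>2 (j\<^sub>1 + \<dots> + j\<^sub>k) - 2 k\<^sup>2\<close> (\<open>len_sum_gen_ge\<close>): any other representation of the same integer must cancel
some \<open>g\<^sub>m\<close> by smaller generators, which takes at least about \<open>m\<^sup>4\<close> of them and costs more than it can save.

\<^bold>\<open>The element.\<close> Let \<open>\<Phi>\<close> be a limit point of the point masses at \<open>g\<^sub>i\<close> divided by \<open>4 ^ i\<close>
in the bidual. Its \<open>k\<close>-th power is an iterated limit
of point masses at sums of \<open>k\<close> generators, divided by \<open>4 ^ (j\<^sub>1 + \<dots> + j\<^sub>k)\<close>, where the indices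
\<open>j\<^sub>1, \<dots>, j\<^sub>k\<close> may be taken distinct and large. Testing it
against the functional \<open>f \<mapsto> \<Sum> f(n) \<omega>(n)\<close> gives at least \<open>2 ^ (- 2 k\<^sup>2)\<close>, so no power vanishes
(\<open>not_nilpotent\<close>).

\<^bold>\<open>The radical.\<close> For an arbitrary \<open>\<Psi>\<close> in the bidual, \<open>(\<Psi> \<box> \<Phi>)\<^sup>k\<close> is an iterated limit over points of \<open>\<int>\<close>
coming alternately from \<open>\<Psi>\<close> and from \<open>\<Phi>\<close>. Since \<open>\<int>\<close> is commutative and \<open>\<omega>\<close> submultiplicative,
the points coming from \<open>\<Psi>\<close> can be split off from those coming from \<open>\<Phi>\<close>; they contribute at most
\<open>\<parallel>\<Psi>\<parallel>\<^sup>k\<close>, and what remains is the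
weight of the sum of \<open>k\<close> generators divided by \<open>4 ^ (j\<^sub>1 + \<dots> + j\<^sub>k)\<close> (\<open>power_arens_bound\<close>). Hence
\<open>\<parallel>(\<Psi> \<box> \<Phi>)\<^sup>k\<parallel> \<le> \<parallel>\<Psi>\<parallel>\<^sup>k 2 ^ (- k (k - 1) / 2)\<close>, and the \<open>k\<close>-th roots tend to \<open>0\<close>.\<close>

section \<open>A length function on the integers\<close>

text \<open>Any sequence whose term at index \<open>1\<close> is \<open>1\<close> and whose \<open>m\<close>-th term, for \<open>m \<ge> 2\<close>, is at least \<open>2 m\<^sup>2 + m\<close> times
the one before would serve; here this ratio is \<open>m\<^sup>4\<close>. The value \<open>1\<close> at index \<open>1\<close> makes every integer representable.\<close>

definition gen :: "nat \<Rightarrow> nat" where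
  "gen m = fact m ^ 4"

definition tail_mass :: "nat \<Rightarrow> (nat \<Rightarrow> int) \<Rightarrow> nat \<Rightarrow> nat" where
  "tail_mass M x s = (\<Sum>i=s..M. nat \<bar>x i\<bar>)"

text \<open>The linear term makes generators of large index expensive. The capped terms are what
makes a sum of \<open>k\<close> generators cheaper than its summands: level \<open>s\<close> counts at most \<open>s\<close> of them, so the
saving is quadratic in \<open>k\<close> but, for large indices, bounded independently of them.\<close>

definition cost :: "nat \<Rightarrow> (nat \<Rightarrow> int) \<Rightarrow> nat" where
  "cost M x = (\<Sum>i=1..M. i * nat \<bar>x i\<bar>) + (\<Sum>s=1..M. min s (tail_mass M x s))"

definition represents :: "nat \<Rightarrow> (nat \<Rightarrow> int) \<Rightarrow> int \<Rightarrow> bool" where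
  "represents M x n \<longleftrightarrow> (\<forall>i>M. x i = 0) \<and> (\<Sum>i=1..M. x i * int (gen i)) = n"

definition len :: "int \<Rightarrow> nat" where
  "len n = (LEAST c. \<exists>M x. represents M x n \<and> cost M x = c)"

lemma represents_extend:
  assumes "represents M x n" "M \<le> M'"
  shows "represents M' x n" "cost M' x = cost M x"
proof -
  have z: "x i = 0" if "i > M" for i using assms that by (auto simp: represents_def)
  have *: "(\<Sum>i=s..M'. h i (x i)) = (\<Sum>i=s..M. h i (x i))" if "\<And>i. h i 0 = 0"
    for s and h :: "nat \<Rightarrow> int \<Rightarrow> 'b::comm_monoid_add"
    using assms(2) z that by (intro sum.mono_neutral_right) auto
  show "represents M' x n"
    using assms z *[of "\<lambda>i a. a * int (gen i)"] by (auto simp: represents_def)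
  have t: "tail_mass M' x s = tail_mass M x s" for s
    unfolding tail_mass_def by (rule *) simp
  have "tail_mass M x s = 0" if "s > M" for s
    using that by (simp add: tail_mass_def)
  then have "(\<Sum>s=1..M'. min s (tail_mass M x s)) = (\<Sum>s=1..M. min s (tail_mass M x s))"
    using assms(2) by (intro sum.mono_neutral_right) auto
  then show "cost M' x = cost M x"
    using *[of "\<lambda>i a. i * nat \<bar>a\<bar>" 1] by (simp add: cost_def t)
qed

lemma represents_exists: "\<exists>M x. represents M x n"
proof (intro exI)
  show "represents 1 (\<lambda>i. if i = 1 then n else 0) n"
    by (simp add: represents_def gen_def)
qed

lemma len_attained: obtains M x where "represents M x n" "cost M x = len n"
proof -
  have "\<exists>c M x. represents M x n \<and> cost M x = c" using represents_exists by blast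
  then have "\<exists>M x. represents M x n \<and> cost M x = len n"
    unfolding len_def by (rule LeastI_ex)
  then show ?thesis using that by blast
qed

lemma len_le: "represents M x n \<Longrightarrow> len n \<le> cost M x"
  unfolding len_def by (rule Least_le) auto

lemma min_le_add: "c \<le> a + b \<Longrightarrow> min s c \<le> min s a + min s b" for s a b c :: nat
  by (auto simp: min_def)

lemma len_add: "len (m + n) \<le> len m + len n"
proof -
  obtain M x where x: "represents M x m" "cost M x = len m" by (rule len_attained)
  obtain N y where y: "represents N y n" "cost N y = len n" by (rule len_attained)
  define K where "K = max M N"
  have K: "represents K x m" "represents K y n" "cost K x = len m" "cost K y = len n"
    using x y represents_extend[of M x m K] represents_extend[of N y n K]
    by (auto simp: K_def)
  let ?z = "\<lambda>i. x i + y i"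
  have "represents K ?z (m + n)"
    using K(1,2) by (auto simp: represents_def sum.distrib algebra_simps)
  then have "len (m + n) \<le> cost K ?z" by (rule len_le)
  also have "cost K ?z \<le> cost K x + cost K y"
  proof -
    have a: "nat \<bar>?z i\<bar> \<le> nat \<bar>x i\<bar> + nat \<bar>y i\<bar>" for i by linarith
    have "tail_mass K ?z s \<le> tail_mass K x s + tail_mass K y s" for s
      unfolding tail_mass_def sum.distrib[symmetric] using a by (intro sum_mono)
    then have b: "min s (tail_mass K ?z s) \<le> min s (tail_mass K x s) + min s (tail_mass K y s)" for s
      by (simp add: min_le_add)
    have "i * nat \<bar>?z i\<bar> \<le> i * nat \<bar>x i\<bar> + i * nat \<bar>y i\<bar>" for i
      using mult_le_mono2[OF a[of i], of i] by (simp add: distrib_left)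
    then have "(\<Sum>i=1..K. i * nat \<bar>?z i\<bar>) \<le> (\<Sum>i=1..K. i * nat \<bar>x i\<bar>) + (\<Sum>i=1..K. i * nat \<bar>y i\<bar>)"
      unfolding sum.distrib[symmetric] by (intro sum_mono)
    moreover have "(\<Sum>s=1..K. min s (tail_mass K ?z s)) \<le>
        (\<Sum>s=1..K. min s (tail_mass K x s)) + (\<Sum>s=1..K. min s (tail_mass K y s))"
      unfolding sum.distrib[symmetric] using b by (intro sum_mono)
    ultimately show ?thesis by (simp add: cost_def)
  qed
  finally show ?thesis using K by simp
qed

lemma len_0: "len 0 = 0"
proof -
  have "represents 0 (\<lambda>_. 0) 0" by (simp add: represents_def)
  then show ?thesis using len_le[of 0 "\<lambda>_. 0" 0] by (simp add: cost_def)
qed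

text \<open>All \<open>k\<close> indices lie at or above each level \<open>s \<le> k\<close>, so that the cap saves \<open>k - s\<close> there. Without
caps the tail masses would add up to the sum of the indices once more, which gives the factor \<open>2\<close>.\<close>

lemma len_sum_gen_le:
  assumes "\<And>j. j \<in> set js \<Longrightarrow> length js \<le> j"
  shows "len (int (sum_list (map gen js))) + (\<Sum>s=1..length js. length js - s) \<le> 2 * sum_list js"
proof (cases "js = []")
  case True
  then show ?thesis by (simp add: len_0)
next
  case False
  define k where "k = length js"
  define M where "M = sum_list js"
  let ?x = "\<lambda>i. int (count_list js i)"
  have mem: "1 \<le> j" "j \<le> M" if "j \<in> set js" for j
  proof -
    have "0 < length js" using False by simp
    then show "1 \<le> j" using assms[OF that] by linarith
    show "j \<le> M" unfolding M_def using that by (intro member_le_sum_list) auto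
  qed
  have "hd js \<in> set js" using False by simp
  then have kM: "k \<le> M" using assms[of "hd js"] mem(2)[of "hd js"] by (simp add: k_def)
  have sub: "set js \<subseteq> {s..M}" if "s \<le> k" "s \<le> M" for s
  proof
    fix j assume "j \<in> set js"
    then show "j \<in> {s..M}" using assms[of j] that mem[of j] by (simp add: k_def)
  qed
  have sub1: "set js \<subseteq> {1..M}" using mem by auto
  have "represents M ?x (int (sum_list (map gen js)))"
    using mem unfolding represents_def sum_list_map_eq_sum_count2[OF sub1 finite_atLeastAtMost]
    by (force simp: count_list_0_iff)
  then have "len (int (sum_list (map gen js))) \<le> cost M ?x" by (rule len_le)
  moreover have "cost M ?x + (\<Sum>s=1..k. k - s) \<le> 2 * sum_list js"
  proof -
    have one: "(\<Sum>i=1..M. i * count_list js i) = sum_list js"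
      using sum_list_map_eq_sum_count2[OF sub1 finite_atLeastAtMost, of id] by (simp add: mult.commute)
    have full: "tail_mass M ?x s = k" if "s \<le> k" for s
      using sum_list_map_eq_sum_count2[OF sub[of s] finite_atLeastAtMost, of "\<lambda>_. 1"] that kM
      by (simp add: tail_mass_def k_def sum_list_triv)
    have "(\<Sum>s=1..M. tail_mass M ?x s) = (\<Sum>s=1..M. \<Sum>i=1..M. if s \<le> i then count_list js i else 0)"
      by (auto simp: tail_mass_def sum.If_cases intro!: sum.cong)
    also have "\<dots> = (\<Sum>i=1..M. \<Sum>s=1..M. if s \<le> i then count_list js i else 0)"
      by (rule sum.swap)
    also have "\<dots> = (\<Sum>i=1..M. i * count_list js i)"
    proof (rule sum.cong)
      fix i assume "i \<in> {1..M}"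
      then have "{1..M} \<inter> {s. s \<le> i} = {1..i}" by auto
      then show "(\<Sum>s=1..M. if s \<le> i then count_list js i else 0) = i * count_list js i"
        by (simp add: sum.If_cases)
    qed simp
    finally have two: "(\<Sum>s=1..M. tail_mass M ?x s) = sum_list js" using one by simp
    have "(\<Sum>s=1..M. min s (tail_mass M ?x s)) + (\<Sum>s=1..k. k - s)
        = (\<Sum>s=1..M. min s (tail_mass M ?x s) + (if s \<le> k then k - s else 0))"
    proof -
      have "{1..M} \<inter> {s. s \<le> k} = {1..k}" using kM by auto
      then show ?thesis by (simp add: sum.distrib sum.If_cases)
    qed
    also have "\<dots> \<le> (\<Sum>s=1..M. tail_mass M ?x s)"
      using full by (intro sum_mono) auto
    finally show ?thesis using one two by (simp add: cost_def)
  qed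
  ultimately show ?thesis by (simp add: k_def)
qed

text \<open>Compare an arbitrary representation \<open>x\<close> with the indicator function of \<open>F\<close>, and let \<open>m\<close> be the
largest index at which they differ. Discarding the cost of \<open>F\<close> up to \<open>m\<close> saves at most
\<open>m\<^sup>2 + m k\<close>, where \<open>k = card F\<close>, but \<open>x\<close> has to cancel a nonzero multiple of \<open>gen m\<close> by smaller
generators and so has mass at least about \<open>m\<^sup>4\<close> below \<open>m\<close>, which outweighs the saving up to a
multiple of \<open>k\<^sup>2\<close>.\<close>

lemma cost_ge_of_represents_subset_sum:
  assumes F: "finite F" "0 \<notin> F" and "represents M0 y (\<Sum>i\<in>F. int (gen i))"
  shows "2 * \<Sum>F \<le> cost M0 y + 2 * (card F)\<^sup>2"
proof -
  \<comment> \<open>Enlarging the range makes room for all of \<open>F\<close> and does not change the cost.\<close>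
  define M where "M = M0 + \<Sum>F"
  define k where "k = card F"
  define x where "x = y"
  have rep: "represents M x (\<Sum>i\<in>F. int (gen i))" and c: "cost M x = cost M0 y"
    using represents_extend[OF assms(3), of M] by (auto simp: M_def x_def)
  have FM: "F \<subseteq> {1..M}"
  proof
    fix i assume "i \<in> F"
    then have "i \<le> \<Sum>F" using member_le_sum[of i F id] F by simp
    then show "i \<in> {1..M}" using F \<open>i \<in> F\<close> by (cases i) (auto simp: M_def)
  qed
  define d where "d i = x i - of_bool (i \<in> F)" for i
  have "(\<Sum>i=1..M. of_bool (i \<in> F) * int (gen i)) = (\<Sum>i\<in>F. int (gen i))"
    using FM F by (simp add: of_bool_def if_distrib[of "\<lambda>a. a * _"] sum.If_cases
        Int_absorb1 Int_def[symmetric] cong: if_cong)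
  then have dsum: "(\<Sum>i=1..M. d i * int (gen i)) = 0"
    using rep by (simp add: d_def represents_def left_diff_distrib sum_subtractf)
  \<comment> \<open>The value \<open>0\<close> stands for the case that there is no difference.\<close>
  define m where "m = Max (insert 0 {i\<in>{1..M}. d i \<noteq> 0})"
  have m_max: "d i = 0" if "m < i" "i \<le> M" for i
  proof (rule ccontr)
    assume "d i \<noteq> 0"
    then have "i \<le> m" unfolding m_def using that by (intro Max_ge) auto
    then show False using that by simp
  qed
  have m_mem: "m \<in> insert 0 {i\<in>{1..M}. d i \<noteq> 0}" unfolding m_def by (rule Max_in) auto
  then have mM: "m \<le> M" by auto
  \<comment> \<open>The terms up to \<open>m\<close> of \<open>dsum\<close> cancel, and \<open>gen m\<close> is \<open>m ^ 4\<close> times the next smaller generator; this is impossible for \<open>m = 1\<close>.\<close>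
  have big: "m ^ 4 \<le> (\<Sum>i=1..<m. nat \<bar>x i\<bar>) + (m - 1) \<and> m \<noteq> 1" if "m \<noteq> 0"
  proof -
    have dm: "d m \<noteq> 0" "1 \<le> m" using m_mem that by auto
    then obtain p where p: "m = Suc p" by (cases m) auto
    have "(\<Sum>i=1..M. d i * int (gen i)) = (\<Sum>i=1..m. d i * int (gen i))"
      using m_max mM by (intro sum.mono_neutral_right) auto
    also have "\<dots> = (\<Sum>i=1..p. d i * int (gen i)) + d m * int (gen m)"
      by (simp add: p)
    finally have "d m * int (gen m) = - (\<Sum>i=1..p. d i * int (gen i))"
      using dsum by linarith
    then have "\<bar>d m * int (gen m)\<bar> = \<bar>\<Sum>i=1..p. d i * int (gen i)\<bar>"
      by simp
    then have "\<bar>d m\<bar> * int (gen m) = \<bar>\<Sum>i=1..p. d i * int (gen i)\<bar>"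
      by (simp add: abs_mult)
    also have "\<dots> \<le> (\<Sum>i=1..p. \<bar>d i\<bar> * int (gen i))"
      by (rule order_trans[OF sum_abs]) (simp add: abs_mult)
    also have "\<dots> \<le> (\<Sum>i=1..p. \<bar>d i\<bar> * int (gen p))"
      by (intro sum_mono mult_left_mono) (auto simp: gen_def fact_mono power_mono)
    also have "\<dots> = (\<Sum>i=1..p. \<bar>d i\<bar>) * int (gen p)" by (simp add: sum_distrib_right)
    finally have "\<bar>d m\<bar> * int (gen m) \<le> (\<Sum>i=1..p. \<bar>d i\<bar>) * int (gen p)" .
    moreover have "gen m = m ^ 4 * gen p"
      by (simp only: gen_def p fact_Suc of_nat_id power_mult_distrib)
    ultimately have "\<bar>d m\<bar> * int (m ^ 4) * int (gen p) \<le> (\<Sum>i=1..p. \<bar>d i\<bar>) * int (gen p)"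
      by (simp only: of_nat_mult mult.assoc)
    moreover have "int (gen p) > 0" by (simp add: gen_def)
    ultimately have "\<bar>d m\<bar> * int (m ^ 4) \<le> (\<Sum>i=1..p. \<bar>d i\<bar>)"
      by (rule mult_right_le_imp_le)
    moreover have "int (m ^ 4) \<le> \<bar>d m\<bar> * int (m ^ 4)"
      using dm(1) mult_right_mono[of 1 "\<bar>d m\<bar>" "int (m ^ 4)"] by simp
    moreover have "(\<Sum>i=1..p. \<bar>d i\<bar>) \<le> (\<Sum>i=1..p. \<bar>x i\<bar> + 1)"
      by (intro sum_mono) (auto simp: d_def)
    moreover have "\<dots> = int (\<Sum>i=1..<m. nat \<bar>x i\<bar>) + int p"
      by (simp add: sum.distrib p atLeastLessThanSuc_atLeastAtMost)
    ultimately have "int (m ^ 4) \<le> int (\<Sum>i=1..<m. nat \<bar>x i\<bar>) + int p" by linarith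
    then have *: "m ^ 4 \<le> (\<Sum>i=1..<m. nat \<bar>x i\<bar>) + p"
      by (metis of_nat_add of_nat_le_iff)
    then have "m \<noteq> 1" using p by (intro notI) simp
    then show ?thesis using * p by simp
  qed
  have xF: "nat \<bar>x i\<bar> = of_bool (i \<in> F)" if "m < i" "i \<le> M" for i
    using m_max[OF that] by (simp add: d_def)
  \<comment> \<open>Above \<open>m\<close> the coefficients of \<open>x\<close> are those of \<open>F\<close>; the elements of \<open>F\<close> up to \<open>m\<close> add up to at most \<open>m * m\<close>.\<close>
  have first: "\<Sum>F + (\<Sum>i=1..<m. nat \<bar>x i\<bar>) \<le> (\<Sum>i=1..M. i * nat \<bar>x i\<bar>) + m * m"
  proof -
    have F_sum: "\<Sum>F = (\<Sum>i=1..M. i * of_bool (i \<in> F))"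
      using FM F by (simp add: of_bool_def if_distrib[of "\<lambda>a. _ * a"] sum.If_cases
        Int_absorb1 Int_def[symmetric] cong: if_cong)
    have "{1..M} \<inter> {i. i < m} = {1..<m}" using mM by auto
    then have low: "(\<Sum>i=1..<m. nat \<bar>x i\<bar>) = (\<Sum>i=1..M. if i < m then nat \<bar>x i\<bar> else 0)"
      by (simp add: sum.If_cases)
    have "{1..M} \<inter> {i. i \<le> m} = {1..m}" using mM by auto
    then have mm: "m * m = (\<Sum>i=1..M. if i \<le> m then m else 0)"
      by (simp add: sum.If_cases)
    have "i * of_bool (i \<in> F) + (if i < m then nat \<bar>x i\<bar> else 0)
        \<le> i * nat \<bar>x i\<bar> + (if i \<le> m then m else 0)" if "i \<in> {1..M}" for i
    proof (cases "i \<le> m")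
      case True
      then have "(if i \<le> m then m else 0) = m" "i * of_bool (i \<in> F) \<le> m" by auto
      moreover have "(if i < m then nat \<bar>x i\<bar> else 0) \<le> i * nat \<bar>x i\<bar>" using that by simp
      ultimately show ?thesis by linarith
    qed (use xF[of i] that in simp)
    then have "(\<Sum>i=1..M. i * of_bool (i \<in> F) + (if i < m then nat \<bar>x i\<bar> else 0))
        \<le> (\<Sum>i=1..M. i * nat \<bar>x i\<bar> + (if i \<le> m then m else 0))"
      by (rule sum_mono)
    then show ?thesis unfolding F_sum low mm by (simp only: sum.distrib)
  qed
  \<comment> \<open>Levels up to \<open>m\<close> are given up entirely, and the cap matters only at levels up to \<open>k\<close>.\<close>
  have second: "\<Sum>F \<le> (\<Sum>s=1..M. min s (tail_mass M x s)) + m * k + k * k"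
  proof -
    define T where "T s = card (F \<inter> {s..M})" for s
    have Tk: "T s \<le> k" for s unfolding T_def k_def by (intro card_mono F) auto
    have "\<Sum>F = (\<Sum>i\<in>F. \<Sum>s=1..M. if s \<le> i then 1 else 0)"
    proof (rule sum.cong)
      fix i assume "i \<in> F"
      then have "{1..M} \<inter> {s. s \<le> i} = {1..i}" using FM by auto
      then show "i = (\<Sum>s=1..M. if s \<le> i then 1 else 0)" by (simp add: sum.If_cases)
    qed simp
    also have "\<dots> = (\<Sum>s=1..M. \<Sum>i\<in>F. if s \<le> i then 1 else 0)" by (rule sum.swap)
    also have "\<dots> = (\<Sum>s=1..M. T s)"
    proof (rule sum.cong)
      fix s
      have "F \<inter> {i. s \<le> i} = F \<inter> {s..M}" using FM by auto
      then show "(\<Sum>i\<in>F. if s \<le> i then 1 else 0) = T s"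
        using F by (simp add: sum.If_cases T_def)
    qed simp
    also have "\<dots> \<le> (\<Sum>s=1..M. min s (tail_mass M x s) + (if s \<le> m then k else 0) + (if s \<le> k then k else 0))"
    proof (rule sum_mono)
      fix s assume s: "s \<in> {1..M}"
      have "T s = tail_mass M x s" if "s > m"
      proof -
        have "tail_mass M x s = (\<Sum>i=s..M. of_bool (i \<in> F))"
          unfolding tail_mass_def using that xF by (intro sum.cong) auto
        also have "\<dots> = card ({s..M} \<inter> F)"
          by (simp add: of_bool_def sum.If_cases)
        finally show ?thesis by (simp add: T_def Int_commute)
      qed
      then show "T s \<le> min s (tail_mass M x s) + (if s \<le> m then k else 0) + (if s \<le> k then k else 0)"
        using Tk[of s] by (cases "s \<le> m"; cases "s \<le> k") auto
    qed
    also have "\<dots> \<le> (\<Sum>s=1..M. min s (tail_mass M x s)) + m * k + k * k"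
    proof -
      have "card ({1..M} \<inter> {s. s \<le> a}) \<le> card {1..a}" for a by (intro card_mono) auto
      then have "card ({1..M} \<inter> {s. s \<le> a}) \<le> a" for a by simp
      then show ?thesis by (simp add: sum.distrib sum.If_cases add_mono)
    qed
    finally show ?thesis .
  qed
  have "m * m + m * k + k * k \<le> (\<Sum>i=1..<m. nat \<bar>x i\<bar>) + 2 * (k * k)"
  proof (cases "m = 0")
    case False
    with big have b: "m ^ 4 \<le> (\<Sum>i=1..<m. nat \<bar>x i\<bar>) + (m - 1)" and "2 \<le> m" by auto
    have "m * k \<le> m * m + k * k" by (cases "m \<le> k") (auto simp: trans_le_add1 trans_le_add2)
    moreover have "2 * (m * m) + m \<le> m ^ 4"
    proof -
      have "2 * 2 \<le> m * m" using \<open>2 \<le> m\<close> by (intro mult_mono) auto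
      then have "4 * (m * m) \<le> (m * m) * (m * m)" by (intro mult_right_mono) auto
      moreover have "m \<le> m * m" by simp
      ultimately show ?thesis unfolding power4_eq_xxxx mult.assoc by linarith
    qed
    ultimately show ?thesis using b by linarith
  qed simp
  then show ?thesis
    using first second c by (simp add: cost_def k_def power2_eq_square)
qed

lemma len_sum_gen_ge:
  assumes "distinct js" "0 \<notin> set js"
  shows "2 * sum_list js \<le> len (int (sum_list (map gen js))) + 2 * (length js)\<^sup>2"
proof -
  obtain M x where x: "represents M x (int (sum_list (map gen js)))"
    "cost M x = len (int (sum_list (map gen js)))" by (rule len_attained)
  have "int (sum_list (map gen js)) = (\<Sum>i\<in>set js. int (gen i))"
    using assms by (simp add: sum_list_distinct_conv_sum_set)
  then have "2 * \<Sum>(set js) \<le> cost M x + 2 * (card (set js))\<^sup>2"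
    using x assms by (intro cost_ge_of_represents_subset_sum) auto
  then show ?thesis
    using x assms sum_list_distinct_conv_sum_set[of js id] by (simp add: distinct_card)
qed

definition wt :: "int \<Rightarrow> real" where
  "wt n = 2 ^ len n"

lemma wt_ge_1: "wt n \<ge> 1" by (simp add: wt_def)

lemma wt_mult: "wt (m + n) \<le> wt m * wt n"
  by (simp add: wt_def power_add[symmetric] len_add power_increasing)

section \<open>Cluster points of sequences of bounded functions\<close>

text \<open>By Tychonoff's theorem the functions \<open>e i\<close> have a cluster point in a product of discs. Pulling its
neighbourhoods back along \<open>e\<close> gives a filter along which all coordinates converge at once; a
subsequence might not suffice, because there may be uncountably many coordinates.\<close>

lemma pointwise_convergent_subfilter:
  fixes e :: "nat \<Rightarrow> 'l \<Rightarrow> complex"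
  assumes bound: "\<And>i l. cmod (e i l) \<le> R l"
  obtains G \<Phi> where "G \<le> sequentially" "G \<noteq> bot" "\<And>l. ((\<lambda>i. e i l) \<longlongrightarrow> \<Phi> l) G"
proof -
  let ?K = "PiE UNIV (\<lambda>l. cball (0::complex) (R l))"
  have "compactin (product_topology (\<lambda>_. euclidean) UNIV) ?K"
    unfolding compactin_PiE by (simp add: compactin_euclidean_iff)
  then have "compact ?K" by (simp add: euclidean_product_topology)
  moreover have "filtermap e sequentially \<noteq> bot" by (simp add: filtermap_bot_iff)
  moreover have "eventually (\<lambda>y. y \<in> ?K) (filtermap e sequentially)"
    using bound by (auto simp: eventually_filtermap intro!: always_eventually)
  ultimately obtain \<Phi> where \<Phi>: "inf (nhds \<Phi>) (filtermap e sequentially) \<noteq> bot"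
    unfolding compact_filter by blast
  define G where "G = inf (filtercomap e (nhds \<Phi>)) sequentially"
  have "G \<noteq> bot"
  proof
    assume "G = bot"
    then have "eventually (\<lambda>_. False) G" by simp
    then obtain P Q where P: "eventually P (filtercomap e (nhds \<Phi>))"
      and Q: "eventually Q sequentially" and PQ: "\<And>i. P i \<Longrightarrow> Q i \<Longrightarrow> False"
      unfolding G_def eventually_inf by blast
    obtain S where S: "eventually S (nhds \<Phi>)" "\<And>i. S (e i) \<Longrightarrow> P i"
      using P unfolding eventually_filtercomap by blast
    have "eventually (\<lambda>y. \<not> S y) (filtermap e sequentially)"
      unfolding eventually_filtermap using Q by (rule eventually_mono) (use S PQ in blast)
    then have "eventually (\<lambda>_. False) (inf (nhds \<Phi>) (filtermap e sequentially))"
      unfolding eventually_inf using S(1) by blast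
    then show False using \<Phi> by (simp add: trivial_limit_def)
  qed
  moreover have "G \<le> sequentially" by (simp add: G_def)
  moreover have "((\<lambda>i. e i l) \<longlongrightarrow> \<Phi> l) G" for l
  proof -
    have "filterlim e (nhds \<Phi>) G"
      by (rule filterlim_mono[OF filterlim_filtercomap]) (auto simp: G_def)
    then show ?thesis
      by (rule continuous_on_tendsto_compose[OF continuous_on_product_coordinates]) auto
  qed
  ultimately show ?thesis using that by blast
qed


section \<open>Norms of functionals\<close>

lemma bounded_functionalsD:
  assumes "\<phi> \<in> bounded_functionals V"
  shows "\<phi> \<in> extensional (carrier V)"
    and "x \<in> carrier V \<Longrightarrow> y \<in> carrier V \<Longrightarrow> \<phi> (vadd V x y) = \<phi> x + \<phi> y"
    and "x \<in> carrier V \<Longrightarrow> \<phi> (vscale V c x) = c * \<phi> x"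
  using assms by (auto simp: bounded_functionals_def)

lemma bounded_functionals_bound:
  assumes "\<phi> \<in> bounded_functionals V"
  obtains C where "\<And>x. x \<in> carrier V \<Longrightarrow> cmod (\<phi> x) \<le> C * vnorm V x"
  using assms unfolding bounded_functionals_def by blast

lemma vnorm_dual_le:
  assumes "\<And>x. x \<in> carrier V \<Longrightarrow> vnorm V x \<le> 1 \<Longrightarrow> cmod (\<phi> x) \<le> K"
    and "\<exists>x \<in> carrier V. vnorm V x \<le> 1"
  shows "vnorm (dual V) \<phi> \<le> K"
  unfolding dual_def using assms by (auto intro!: cSUP_least)

lemma le_vnorm_dual:
  assumes "\<And>x. x \<in> carrier V \<Longrightarrow> vnorm V x \<le> 1 \<Longrightarrow> cmod (\<phi> x) \<le> K"
    and "x \<in> carrier V" "vnorm V x \<le> 1"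
  shows "cmod (\<phi> x) \<le> vnorm (dual V) \<phi>"
  unfolding dual_def using assms
  by (auto intro!: cSUP_upper bdd_aboveI2[where M = K])

section \<open>Beurling algebras\<close>

definition delta :: "int \<Rightarrow> int \<Rightarrow> complex" where
  "delta m = (\<lambda>n. if n = m then 1 else 0)"

locale beurling_weight =
  fixes \<omega> :: "int \<Rightarrow> real"
  assumes weight: "weight \<omega>"
begin

abbreviation A where "A \<equiv> beurling \<omega>"
abbreviation D where "D \<equiv> dual_of A"
abbreviation BD where "BD \<equiv> bidual_of A"

lemma \<omega>_ge_1: "\<omega> n \<ge> 1" and \<omega>_0: "\<omega> 0 = 1" and \<omega>_add: "\<omega> (m + n) \<le> \<omega> m * \<omega> n"
  using weight by (auto simp: weight_def)

lemma \<omega>_pos [simp]: "\<omega> n > 0" "\<omega> n \<ge> 0" "\<omega> n \<noteq> 0"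
  using \<omega>_ge_1[of n] by auto

lemma carrier_iff: "f \<in> carrier A \<longleftrightarrow> (\<lambda>n. cmod (f n) * \<omega> n) summable_on UNIV"
  by (simp add: beurling_def)

lemma nrm_eq: "nrm A f = (\<Sum>\<^sub>\<infinity>n. cmod (f n) * \<omega> n)"
  by (simp add: beurling_def)

lemma mult_eq: "f \<otimes>\<^bsub>A\<^esub> g = (\<lambda>n. \<Sum>\<^sub>\<infinity>k. f k * g (n - k))"
  by (simp add: beurling_def)

lemma V_simps [simp]:
  "carrier (vector_space_of A) = carrier A" "vnorm (vector_space_of A) = nrm A"
  "vadd (vector_space_of A) f g = (\<lambda>n. f n + g n)"
  "vscale (vector_space_of A) c f = (\<lambda>n. c * f n)"
  by (simp_all add: vector_space_of_def beurling_def)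

lemma D_simps:
  "carrier D = bounded_functionals (vector_space_of A)"
  "vadd D l l' = (\<lambda>f \<in> carrier A. l f + l' f)"
  "vscale D c l = (\<lambda>f \<in> carrier A. c * l f)"
  by (simp_all add: dual_def)

lemma nrm_nonneg: "nrm A f \<ge> 0"
  unfolding nrm_eq by (intro infsum_nonneg) simp

lemma delta_mem [simp]: "delta m \<in> carrier A"
  and nrm_scaled_delta: "nrm A (\<lambda>n. c * delta m n) = cmod c * \<omega> m"
proof -
  have *: "((\<lambda>n. cmod (c * delta m n) * \<omega> n) has_sum (cmod c * \<omega> m)) UNIV" for c
    by (rule has_sum_finite_neutralI[of "{m}"]) (auto simp: delta_def)
  show "delta m \<in> carrier A" using *[of 1] by (auto simp: carrier_iff summable_on_def)
  show "nrm A (\<lambda>n. c * delta m n) = cmod c * \<omega> m"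
    unfolding nrm_eq using *[of c] by (rule infsumI)
qed

lemma nrm_delta: "nrm A (delta m) = \<omega> m"
  using nrm_scaled_delta[of 1 m] by simp

lemma add_mem: "f \<in> carrier A \<Longrightarrow> g \<in> carrier A \<Longrightarrow> (\<lambda>n. f n + g n) \<in> carrier A"
  unfolding carrier_iff
proof -
  assume "(\<lambda>n. cmod (f n) * \<omega> n) summable_on UNIV" "(\<lambda>n. cmod (g n) * \<omega> n) summable_on UNIV"
  from summable_on_add[OF this] show "(\<lambda>n. cmod (f n + g n) * \<omega> n) summable_on UNIV"
    by (rule summable_on_comparison_test)
       (simp_all add: distrib_right[symmetric] mult_right_mono norm_triangle_ineq)
qed

lemma scale_mem: "f \<in> carrier A \<Longrightarrow> (\<lambda>n. c * f n) \<in> carrier A"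
  unfolding carrier_iff by (simp add: norm_mult mult.assoc summable_on_cmult_right)

lemma nrm_scale: "nrm A (\<lambda>n. c * f n) = cmod c * nrm A f"
  unfolding nrm_eq by (simp add: norm_mult mult.assoc infsum_cmult_right')

lemma zero_mem: "(\<lambda>n. 0) \<in> carrier A"
  using scale_mem[OF delta_mem, of 0] by simp

lemma unit_ball_nonempty: "\<exists>x\<in>carrier (vector_space_of A). vnorm (vector_space_of A) x \<le> 1"
  using zero_mem by (auto intro!: bexI[of _ "\<lambda>n. 0"] simp: nrm_eq)

text \<open>The substitution \<open>(n, k) \<mapsto> (k, n - k)\<close> and submultiplicativity reduce this to the product of
two absolutely convergent series.\<close>

lemma convolution_summable_pairs:
  assumes "f \<in> carrier A" "g \<in> carrier A"
  shows "(\<lambda>(n, k). cmod (f k * g (n - k)) * \<omega> n) summable_on UNIV \<times> UNIV"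
    and "(\<Sum>\<^sub>\<infinity>(n, k)\<in>UNIV \<times> UNIV. cmod (f k * g (n - k)) * \<omega> n) \<le> nrm A f * nrm A g"
proof -
  let ?F = "\<lambda>(k, j). (cmod (f k) * \<omega> k) * (cmod (g j) * \<omega> j)"
  let ?h = "\<lambda>(n, k). (k, n - k) :: int \<times> int"
  have f: "((\<lambda>n. cmod (f n) * \<omega> n) has_sum nrm A f) UNIV"
    and g: "((\<lambda>n. cmod (g n) * \<omega> n) has_sum nrm A g) UNIV"
    using assms by (auto simp: carrier_iff nrm_eq)
  have row: "((\<lambda>j. ?F (k, j)) has_sum (cmod (f k) * \<omega> k) * nrm A g) UNIV" for k
    using has_sum_cmult_right[OF g] by simp
  have col: "((\<lambda>k. (cmod (f k) * \<omega> k) * nrm A g) has_sum nrm A f * nrm A g) UNIV"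
    using has_sum_cmult_left[OF f] by simp
  have sF: "?F summable_on UNIV \<times> UNIV"
    by (rule summable_on_SigmaI[OF row has_sum_imp_summable[OF col]]) auto
  have F: "(?F has_sum nrm A f * nrm A g) (UNIV \<times> UNIV)"
    by (rule has_sum_SigmaI[OF row col sF])
  have bij: "bij_betw ?h (UNIV \<times> UNIV) (UNIV \<times> UNIV)"
    by (rule bij_betwI[where g = "\<lambda>(k, j). (k + j, k)"]) auto
  have Fh: "((\<lambda>p. ?F (?h p)) has_sum nrm A f * nrm A g) (UNIV \<times> UNIV)"
    using F has_sum_reindex_bij_betw[OF bij, of ?F] by simp
  have le: "(case p of (n, k) \<Rightarrow> cmod (f k * g (n - k)) * \<omega> n) \<le> ?F (?h p)" for p
  proof (cases p)
    case (Pair n k)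
    have "cmod (f k * g (n - k)) * \<omega> n \<le> cmod (f k * g (n - k)) * (\<omega> k * \<omega> (n - k))"
      using \<omega>_add[of k "n - k"] by (intro mult_left_mono) auto
    then show ?thesis by (simp add: Pair norm_mult algebra_simps)
  qed
  show s: "(\<lambda>(n, k). cmod (f k * g (n - k)) * \<omega> n) summable_on UNIV \<times> UNIV"
    using has_sum_imp_summable[OF Fh] by (rule summable_on_comparison_test) (use le in auto)
  show "(\<Sum>\<^sub>\<infinity>(n, k)\<in>UNIV \<times> UNIV. cmod (f k * g (n - k)) * \<omega> n) \<le> nrm A f * nrm A g"
    using has_sum_mono[OF has_sum_infsum[OF s] Fh] le by simp
qed

lemma convolution_abs_summable:
  assumes "f \<in> carrier A" "g \<in> carrier A"
  shows "(\<lambda>k. f k * g (n - k)) abs_summable_on UNIV"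
proof -
  have "(\<lambda>k. cmod (f k * g (n - k)) * \<omega> n) summable_on UNIV"
    using summable_on_SigmaD1[OF convolution_summable_pairs(1)[OF assms], of n] by simp
  then have "(\<lambda>k. cmod (f k * g (n - k)) * \<omega> n * (1 / \<omega> n)) summable_on UNIV"
    by (rule summable_on_cmult_left)
  then show ?thesis by simp
qed

lemma mult_mem [simp]: "f \<in> carrier A \<Longrightarrow> g \<in> carrier A \<Longrightarrow> f \<otimes>\<^bsub>A\<^esub> g \<in> carrier A"
  and nrm_mult_le: "f \<in> carrier A \<Longrightarrow> g \<in> carrier A \<Longrightarrow> nrm A (f \<otimes>\<^bsub>A\<^esub> g) \<le> nrm A f * nrm A g"
proof -
  assume fg: "f \<in> carrier A" "g \<in> carrier A"
  note s = convolution_summable_pairs[OF fg]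
  let ?r = "\<lambda>n. \<Sum>\<^sub>\<infinity>k. cmod (f k * g (n - k)) * \<omega> n"
  have r: "?r summable_on UNIV"
    using summable_on_Sigma_banach[OF s(1)] by simp
  have le: "cmod ((f \<otimes>\<^bsub>A\<^esub> g) n) * \<omega> n \<le> ?r n" for n
  proof -
    have "cmod ((f \<otimes>\<^bsub>A\<^esub> g) n) \<le> (\<Sum>\<^sub>\<infinity>k. cmod (f k * g (n - k)))"
      unfolding mult_eq by (rule norm_infsum_bound[OF convolution_abs_summable[OF fg]])
    then show ?thesis by (simp add: infsum_cmult_left' mult_right_mono)
  qed
  have m: "(\<lambda>n. cmod ((f \<otimes>\<^bsub>A\<^esub> g) n) * \<omega> n) summable_on UNIV"
    using r by (rule summable_on_comparison_test) (use le in auto)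
  then show "f \<otimes>\<^bsub>A\<^esub> g \<in> carrier A" by (simp add: carrier_iff)
  have "nrm A (f \<otimes>\<^bsub>A\<^esub> g) \<le> (\<Sum>\<^sub>\<infinity>n. ?r n)"
    unfolding nrm_eq by (rule infsum_mono[OF m r le])
  also have "\<dots> = (\<Sum>\<^sub>\<infinity>(n, k)\<in>UNIV \<times> UNIV. cmod (f k * g (n - k)) * \<omega> n)"
    using infsum_Sigma_banach[OF s(1)] by simp
  finally show "nrm A (f \<otimes>\<^bsub>A\<^esub> g) \<le> nrm A f * nrm A g" using s(2) by linarith
qed

lemma mult_add_right: "f \<in> carrier A \<Longrightarrow> g \<in> carrier A \<Longrightarrow> h \<in> carrier A \<Longrightarrow>
    f \<otimes>\<^bsub>A\<^esub> (\<lambda>n. g n + h n) = (\<lambda>n. (f \<otimes>\<^bsub>A\<^esub> g) n + (f \<otimes>\<^bsub>A\<^esub> h) n)"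
  and mult_add_left: "f \<in> carrier A \<Longrightarrow> g \<in> carrier A \<Longrightarrow> h \<in> carrier A \<Longrightarrow>
    (\<lambda>n. f n + g n) \<otimes>\<^bsub>A\<^esub> h = (\<lambda>n. (f \<otimes>\<^bsub>A\<^esub> h) n + (g \<otimes>\<^bsub>A\<^esub> h) n)"
  unfolding mult_eq
  by (simp_all add: distrib_left distrib_right infsum_add abs_summable_summable
      convolution_abs_summable)

lemma mult_scale_right: "f \<otimes>\<^bsub>A\<^esub> (\<lambda>n. c * g n) = (\<lambda>n. c * (f \<otimes>\<^bsub>A\<^esub> g) n)"
  and mult_scale_left: "(\<lambda>n. c * f n) \<otimes>\<^bsub>A\<^esub> g = (\<lambda>n. c * (f \<otimes>\<^bsub>A\<^esub> g) n)"
  unfolding mult_eq by (simp_all add: infsum_cmult_right'[symmetric] algebra_simps)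

lemma delta_mult: "delta m \<otimes>\<^bsub>A\<^esub> f = (\<lambda>n. f (n - m))"
proof
  fix n
  have "((\<lambda>k. delta m k * f (n - k)) has_sum f (n - m)) UNIV"
    by (rule has_sum_finite_neutralI[of "{m}"]) (auto simp: delta_def)
  then show "(delta m \<otimes>\<^bsub>A\<^esub> f) n = f (n - m)" unfolding mult_eq by (rule infsumI)
qed

lemma delta_mult_delta: "delta m \<otimes>\<^bsub>A\<^esub> delta n = delta (m + n)"
  unfolding delta_mult by (auto simp: delta_def fun_eq_iff)

lemma one_eq: "\<one>\<^bsub>A\<^esub> = delta 0"
  by (simp add: beurling_def delta_def)

end

section \<open>The dual and the bidual of a Beurling algebra\<close>

context beurling_weight
begin

lemma D_add: "l \<in> carrier D \<Longrightarrow> f \<in> carrier A \<Longrightarrow> g \<in> carrier A \<Longrightarrow> l (\<lambda>n. f n + g n) = l f + l g"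
  and D_scale: "l \<in> carrier D \<Longrightarrow> f \<in> carrier A \<Longrightarrow> l (\<lambda>n. c * f n) = c * l f"
  using bounded_functionalsD(2,3)[of l "vector_space_of A"] by (auto simp: D_simps)

lemma D_bound:
  assumes "l \<in> carrier D" "f \<in> carrier A"
  shows "cmod (l f) \<le> vnorm D l * nrm A f"
proof -
  obtain C where C: "\<And>f. f \<in> carrier A \<Longrightarrow> cmod (l f) \<le> C * nrm A f"
    using assms(1) bounded_functionals_bound[of l "vector_space_of A"] by (auto simp: D_simps)
  have unit: "cmod (l g) \<le> vnorm D l" if "g \<in> carrier A" "nrm A g \<le> 1" for g
  proof (rule le_vnorm_dual)
    fix x assume "x \<in> carrier (vector_space_of A)" "vnorm (vector_space_of A) x \<le> 1"
    then have x: "x \<in> carrier A" "nrm A x \<le> 1" by auto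
    have "cmod (l x) \<le> C * nrm A x" using x by (intro C)
    also have "\<dots> \<le> \<bar>C\<bar> * 1" using x nrm_nonneg[of x] by (intro mult_mono) auto
    finally show "cmod (l x) \<le> \<bar>C\<bar>" by simp
  qed (use that in auto)
  show ?thesis
  proof (cases "nrm A f = 0")
    case True
    then show ?thesis using C[OF assms(2)] by simp
  next
    case False
    then have pos: "nrm A f > 0" using nrm_nonneg[of f] by simp
    let ?c = "complex_of_real (1 / nrm A f)"
    have "nrm A (\<lambda>n. ?c * f n) = 1"
      using pos by (simp only: nrm_scale) (simp add: norm_divide)
    then have "cmod (l (\<lambda>n. ?c * f n)) \<le> vnorm D l"
      using assms(2) by (intro unit scale_mem) simp_all
    then have "cmod (l f) / nrm A f \<le> vnorm D l"
      using pos by (simp only: D_scale[OF assms]) (simp add: norm_mult norm_divide)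
    then show ?thesis using pos by (simp add: field_simps)
  qed
qed

lemma D_delta_bound: "l \<in> carrier D \<Longrightarrow> cmod (l (delta n)) \<le> vnorm D l * \<omega> n"
  using D_bound[of l "delta n"] by (simp add: nrm_delta)

lemma vnorm_D_nonneg: "l \<in> carrier D \<Longrightarrow> 0 \<le> vnorm D l"
  using D_delta_bound[of l 0] norm_ge_zero[of "l (delta 0)"] by (simp add: \<omega>_0 del: norm_ge_zero)

lemma DI:
  assumes "l \<in> extensional (carrier A)"
    and "\<And>f g. f \<in> carrier A \<Longrightarrow> g \<in> carrier A \<Longrightarrow> l (\<lambda>n. f n + g n) = l f + l g"
    and "\<And>c f. f \<in> carrier A \<Longrightarrow> l (\<lambda>n. c * f n) = c * l f"
    and "\<And>f. f \<in> carrier A \<Longrightarrow> cmod (l f) \<le> C * nrm A f"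
  shows "l \<in> carrier D"
proof -
  have "\<exists>C. \<forall>f \<in> carrier A. cmod (l f) \<le> C * nrm A f" using assms(4) by blast
  then show ?thesis using assms(1-3) by (simp add: D_simps bounded_functionals_def)
qed

lemma vnorm_D_le:
  assumes "\<And>f. f \<in> carrier A \<Longrightarrow> cmod (l f) \<le> K * nrm A f" "K \<ge> 0"
  shows "vnorm D l \<le> K"
proof (rule vnorm_dual_le[OF _ unit_ball_nonempty])
  fix f assume f: "f \<in> carrier (vector_space_of A)" "vnorm (vector_space_of A) f \<le> 1"
  then have "cmod (l f) \<le> K * nrm A f" using assms by simp
  also have "\<dots> \<le> K" using f assms(2) by (simp add: mult_left_le)
  finally show "cmod (l f) \<le> K" .
qed

text \<open>Finitely supported functions are dense: on the finite part of \<open>f\<close> the bound on point masses applies,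
and continuity of \<open>l\<close> takes care of the small remainder.\<close>

lemma D_le_of_delta_le:
  assumes l: "l \<in> carrier D" and f: "f \<in> carrier A"
    and le: "\<And>n. cmod (l (delta n)) \<le> K * \<omega> n"
  shows "cmod (l f) \<le> K * nrm A f"
proof (rule field_le_epsilon)
  fix e :: real assume "e > 0"
  define h where "h n = cmod (f n) * \<omega> n" for n
  have h: "h summable_on UNIV" using f by (simp add: carrier_iff h_def[abs_def])
  have K: "K \<ge> 0" using le[of 0] norm_ge_zero[of "l (delta 0)"] by (simp add: \<omega>_0 del: norm_ge_zero)
  have V: "vnorm D l \<ge> 0" using l by (rule vnorm_D_nonneg)
  \<comment> \<open>The summand \<open>1\<close> only guards against division by \<open>0\<close>.\<close>
  define \<eta> where "\<eta> = e / (vnorm D l + 1)"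
  have "\<eta> > 0" using \<open>e > 0\<close> V by (simp add: \<eta>_def)
  obtain F where F: "finite F" "dist (sum h F) (infsum h UNIV) \<le> \<eta>"
    using infsum_finite_approximation[OF h \<open>\<eta> > 0\<close>] by auto
  define t where "t n = (if n \<in> F then 0 else f n)" for n
  have fin: "(\<lambda>n. \<Sum>k\<in>E. f k * delta k n) \<in> carrier A
      \<and> l (\<lambda>n. \<Sum>k\<in>E. f k * delta k n) = (\<Sum>k\<in>E. f k * l (delta k))" if "finite E" for E
    using that
  proof (induction E rule: finite_induct)
    case empty
    show ?case using zero_mem D_scale[OF l zero_mem, of 0] by simp
  next
    case (insert k E)
    then show ?case
      using add_mem[OF scale_mem[OF delta_mem, of "f k" k]]
        D_add[OF l scale_mem[OF delta_mem, of "f k" k]] D_scale[OF l delta_mem]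
      by simp
  qed
  have split: "f = (\<lambda>n. (\<Sum>k\<in>F. f k * delta k n) + t n)"
  proof
    fix n
    have "(\<Sum>k\<in>F. f k * delta k n) = (if n \<in> F then f n else 0)"
      using F(1) by (simp add: delta_def if_distrib[of "\<lambda>a. _ * a"] sum.delta' cong: if_cong)
    then show "f n = (\<Sum>k\<in>F. f k * delta k n) + t n" by (simp add: t_def)
  qed
  have t_sum: "(\<lambda>n. cmod (t n) * \<omega> n) summable_on UNIV"
    using h by (rule summable_on_comparison_test) (auto simp: t_def h_def)
  then have t: "t \<in> carrier A" by (simp add: carrier_iff)
  have "nrm A t = infsum h (UNIV - F)"
    unfolding nrm_eq by (rule infsum_cong_neutral) (auto simp: t_def h_def)
  also have "\<dots> = infsum h UNIV - sum h F"
    using infsum_Un_disjoint[of h F "UNIV - F"] F(1) h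
      summable_on_subset_banach[OF h, of "UNIV - F"] by simp
  finally have "nrm A t \<le> \<eta>" using F(2) by (simp add: dist_real_def)
  have "l f = (\<Sum>k\<in>F. f k * l (delta k)) + l t"
    using D_add[OF l conjunct1[OF fin[OF F(1)]] t] fin[OF F(1)] split by metis
  then have "cmod (l f) \<le> cmod (\<Sum>k\<in>F. f k * l (delta k)) + cmod (l t)"
    using norm_triangle_ineq by simp
  also have "cmod (\<Sum>k\<in>F. f k * l (delta k)) \<le> (\<Sum>k\<in>F. K * h k)"
  proof (intro order_trans[OF norm_sum] sum_mono)
    fix k
    show "cmod (f k * l (delta k)) \<le> K * h k"
      using mult_left_mono[OF le[of k], of "cmod (f k)"] by (simp add: norm_mult h_def algebra_simps)
  qed
  also have "\<dots> \<le> K * nrm A f"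
  proof -
    have "sum h F \<le> nrm A f"
      unfolding nrm_eq h_def[symmetric] using h F(1)
      by (intro finite_sum_le_infsum) (auto simp: h_def)
    then show ?thesis using K by (simp add: sum_distrib_left[symmetric] mult_left_mono)
  qed
  also have "cmod (l t) \<le> vnorm D l * \<eta>"
    using D_bound[OF l t] \<open>nrm A t \<le> \<eta>\<close> V by (meson mult_left_mono order_trans)
  also have "vnorm D l * \<eta> \<le> e"
    using V \<open>e > 0\<close> by (simp add: \<eta>_def field_simps)
  finally show "cmod (l f) \<le> K * nrm A f + e" by simp
qed

lemma vnorm_D_le_delta:
  assumes "l \<in> carrier D" "\<And>n. cmod (l (delta n)) \<le> K * \<omega> n"
  shows "vnorm D l \<le> K"
proof (rule vnorm_D_le)
  show "0 \<le> K" using assms(2)[of 0] norm_ge_zero[of "l (delta 0)"]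
    by (simp add: \<omega>_0 del: norm_ge_zero)
qed (use D_le_of_delta_le assms in blast)

lemma zero_D: "(\<lambda>f \<in> carrier A. 0) \<in> carrier D"
  by (rule DI[where C = 0]) (auto simp: add_mem scale_mem)

lemma vnorm_D_zero: "vnorm D (\<lambda>f \<in> carrier A. 0) \<le> 0"
  by (rule vnorm_D_le) auto

lemma D_add_mem:
  assumes "l \<in> carrier D" "l' \<in> carrier D" shows "vadd D l l' \<in> carrier D"
proof (rule DI)
  fix f assume "f \<in> carrier A"
  then show "cmod (vadd D l l' f) \<le> (vnorm D l + vnorm D l') * nrm A f"
    using D_bound[OF assms(1), of f] D_bound[OF assms(2), of f]
    by (simp add: D_simps(2) distrib_right order_trans[OF norm_triangle_ineq])
qed (auto simp: D_simps(2) D_add[OF assms(1)] D_add[OF assms(2)] D_scale[OF assms(1)] D_scale[OF assms(2)]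
    add_mem scale_mem algebra_simps)

lemma D_scale_mem:
  assumes "l \<in> carrier D" shows "vscale D c l \<in> carrier D"
proof (rule DI)
  fix f assume "f \<in> carrier A"
  then show "cmod (vscale D c l f) \<le> (cmod c * vnorm D l) * nrm A f"
    using D_bound[OF assms(1), of f]
    by (simp add: D_simps(3) norm_mult mult.assoc mult_left_mono)
qed (auto simp: D_simps(3) D_add[OF assms(1)] D_scale[OF assms(1)]
    add_mem scale_mem algebra_simps)

lemma functional_act_eq [simp]: "b \<in> carrier A \<Longrightarrow> functional_act A l a b = l (a \<otimes>\<^bsub>A\<^esub> b)"
  by (simp add: functional_act_def)

lemma functional_act_bound:
  assumes "l \<in> carrier D" "a \<in> carrier A" "b \<in> carrier A"
  shows "cmod (functional_act A l a b) \<le> (vnorm D l * nrm A a) * nrm A b"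
proof -
  have "cmod (functional_act A l a b) \<le> vnorm D l * nrm A (a \<otimes>\<^bsub>A\<^esub> b)"
    using assms D_bound[of l "a \<otimes>\<^bsub>A\<^esub> b"] by simp
  also have "\<dots> \<le> vnorm D l * (nrm A a * nrm A b)"
    using assms by (intro mult_left_mono nrm_mult_le vnorm_D_nonneg)
  finally show ?thesis by (simp add: mult.assoc)
qed

lemma functional_act_mem [simp]:
  assumes "l \<in> carrier D" "a \<in> carrier A"
  shows "functional_act A l a \<in> carrier D"
proof (rule DI)
  show "functional_act A l a \<in> extensional (carrier A)" by (simp add: functional_act_def)
qed (use assms functional_act_bound in
    \<open>auto simp: add_mem scale_mem mult_add_right mult_scale_right D_add D_scale\<close>)

lemma vnorm_functional_act_le:
  assumes "l \<in> carrier D" "a \<in> carrier A"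
  shows "vnorm D (functional_act A l a) \<le> vnorm D l * nrm A a"
  using assms by (intro vnorm_D_le functional_act_bound mult_nonneg_nonneg vnorm_D_nonneg nrm_nonneg)

lemma functional_act_add:
  assumes "l \<in> carrier D" "a \<in> carrier A" "b \<in> carrier A"
  shows "functional_act A l (\<lambda>n. a n + b n) = vadd D (functional_act A l a) (functional_act A l b)"
  using assms by (auto simp: D_simps(2) functional_act_def mult_add_left D_add intro!: restrict_ext)

lemma functional_act_scale:
  assumes "l \<in> carrier D" "a \<in> carrier A"
  shows "functional_act A l (\<lambda>n. c * a n) = vscale D c (functional_act A l a)"
  using assms by (auto simp: D_simps(3) functional_act_def mult_scale_left D_scale intro!: restrict_ext)

lemma functional_act_vadd:
  "a \<in> carrier A \<Longrightarrow>
    functional_act A (vadd D l l') a = vadd D (functional_act A l a) (functional_act A l' a)"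
  by (auto simp: D_simps(2) functional_act_def intro!: restrict_ext)

lemma functional_act_vscale:
  "a \<in> carrier A \<Longrightarrow> functional_act A (vscale D c l) a = vscale D c (functional_act A l a)"
  by (auto simp: D_simps(3) functional_act_def intro!: restrict_ext)

lemma BD_simps: "carrier BD = bounded_functionals D"
  by (simp add: dual_def)

lemma BD_add: "\<Phi> \<in> carrier BD \<Longrightarrow> l \<in> carrier D \<Longrightarrow> l' \<in> carrier D \<Longrightarrow> \<Phi> (vadd D l l') = \<Phi> l + \<Phi> l'"
  and BD_scale: "\<Phi> \<in> carrier BD \<Longrightarrow> l \<in> carrier D \<Longrightarrow> \<Phi> (vscale D c l) = c * \<Phi> l"
  using bounded_functionalsD(2,3)[of \<Phi> D] by (auto simp: BD_simps)

lemma BD_bound: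
  assumes "\<Phi> \<in> carrier BD"
  obtains C where "C \<ge> 0" "\<And>l. l \<in> carrier D \<Longrightarrow> cmod (\<Phi> l) \<le> C * vnorm D l"
proof -
  obtain C where C: "\<And>l. l \<in> carrier D \<Longrightarrow> cmod (\<Phi> l) \<le> C * vnorm D l"
    using assms bounded_functionals_bound[of \<Phi> D] by (auto simp: BD_simps)
  have "cmod (\<Phi> l) \<le> \<bar>C\<bar> * vnorm D l" if "l \<in> carrier D" for l
    using C[OF that] mult_right_mono[OF abs_ge_self vnorm_D_nonneg[OF that], of C] by linarith
  then show ?thesis using that[of "\<bar>C\<bar>"] by simp
qed

lemma BDI:
  assumes "\<Phi> \<in> extensional (carrier D)"
    and "\<And>l l'. l \<in> carrier D \<Longrightarrow> l' \<in> carrier D \<Longrightarrow> \<Phi> (vadd D l l') = \<Phi> l + \<Phi> l'"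
    and "\<And>c l. l \<in> carrier D \<Longrightarrow> \<Phi> (vscale D c l) = c * \<Phi> l"
    and "\<And>l. l \<in> carrier D \<Longrightarrow> cmod (\<Phi> l) \<le> C * vnorm D l"
  shows "\<Phi> \<in> carrier BD"
  using assms unfolding BD_simps bounded_functionals_def by blast

lemma bidual_act_eq [simp]: "a \<in> carrier A \<Longrightarrow> bidual_act A \<Phi> l a = \<Phi> (functional_act A l a)"
  by (simp add: bidual_act_def)

lemma bidual_act_bound:
  assumes "C \<ge> 0" "\<And>l. l \<in> carrier D \<Longrightarrow> cmod (\<Phi> l) \<le> C * vnorm D l"
    and "l \<in> carrier D" "a \<in> carrier A"
  shows "cmod (bidual_act A \<Phi> l a) \<le> (C * vnorm D l) * nrm A a"
proof -
  have "cmod (bidual_act A \<Phi> l a) \<le> C * vnorm D (functional_act A l a)"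
    using assms by simp
  also have "\<dots> \<le> C * (vnorm D l * nrm A a)"
    using assms by (intro mult_left_mono vnorm_functional_act_le)
  finally show ?thesis by (simp add: mult.assoc)
qed

lemma bidual_act_mem [simp]:
  assumes "\<Phi> \<in> carrier BD" "l \<in> carrier D"
  shows "bidual_act A \<Phi> l \<in> carrier D"
proof -
  obtain C where C: "C \<ge> 0" "\<And>l. l \<in> carrier D \<Longrightarrow> cmod (\<Phi> l) \<le> C * vnorm D l"
    using BD_bound[OF assms(1)] by blast
  show ?thesis
  proof (rule DI)
    show "bidual_act A \<Phi> l \<in> extensional (carrier A)" by (simp add: bidual_act_def)
  qed (use assms bidual_act_bound[OF C assms(2)] in
      \<open>auto simp: add_mem scale_mem functional_act_add functional_act_scale BD_add BD_scale\<close>)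
qed

lemma arens_mem:
  assumes "\<Psi> \<in> carrier BD" "\<Phi> \<in> carrier BD"
  shows "arens_product A \<Psi> \<Phi> \<in> carrier BD"
proof -
  obtain C where C: "C \<ge> 0" "\<And>l. l \<in> carrier D \<Longrightarrow> cmod (\<Phi> l) \<le> C * vnorm D l"
    using BD_bound[OF assms(2)] by blast
  obtain C' where C': "C' \<ge> 0" "\<And>l. l \<in> carrier D \<Longrightarrow> cmod (\<Psi> l) \<le> C' * vnorm D l"
    using BD_bound[OF assms(1)] by blast
  have add: "bidual_act A \<Phi> (vadd D l l') = vadd D (bidual_act A \<Phi> l) (bidual_act A \<Phi> l')"
    if "l \<in> carrier D" "l' \<in> carrier D" for l l'
  proof -
    have "bidual_act A \<Phi> (vadd D l l')
        = (\<lambda>a \<in> carrier A. \<Phi> (functional_act A l a) + \<Phi> (functional_act A l' a))"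
      unfolding bidual_act_def using that assms
      by (intro restrict_ext) (simp add: functional_act_vadd BD_add)
    then show ?thesis by (auto simp: D_simps(2) intro!: restrict_ext)
  qed
  have scale: "bidual_act A \<Phi> (vscale D c l) = vscale D c (bidual_act A \<Phi> l)"
    if "l \<in> carrier D" for l c
  proof -
    have "bidual_act A \<Phi> (vscale D c l) = (\<lambda>a \<in> carrier A. c * \<Phi> (functional_act A l a))"
      unfolding bidual_act_def using that assms
      by (intro restrict_ext) (simp add: functional_act_vscale BD_scale)
    then show ?thesis by (auto simp: D_simps(3) intro!: restrict_ext)
  qed
  show ?thesis
  proof (rule BDI)
    fix l assume l: "l \<in> carrier D"
    have "cmod (arens_product A \<Psi> \<Phi> l) \<le> C' * vnorm D (bidual_act A \<Phi> l)"
      using l assms C' by (simp add: arens_product_def)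
    also have "\<dots> \<le> C' * (C * vnorm D l)"
      using l C C'(1) vnorm_D_nonneg[OF l]
      by (intro mult_left_mono vnorm_D_le bidual_act_bound) auto
    finally show "cmod (arens_product A \<Psi> \<Phi> l) \<le> (C' * C) * vnorm D l" by (simp add: mult.assoc)
  qed (use assms in \<open>auto simp: arens_product_def D_add_mem D_scale_mem add scale BD_add BD_scale\<close>)
qed

lemma bidual_algebra_simps:
  "carrier (bidual_algebra A) = carrier BD"
  "x \<otimes>\<^bsub>bidual_algebra A\<^esub> y = arens_product A x y"
  "\<one>\<^bsub>bidual_algebra A\<^esub> = (\<lambda>l \<in> carrier D. l (delta 0))"
  "\<zero>\<^bsub>bidual_algebra A\<^esub> = (\<lambda>l \<in> carrier D. 0)"
  "nrm (bidual_algebra A) = vnorm BD"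
  by (simp_all add: bidual_algebra_def one_eq)

abbreviation power_BD where "power_BD B k \<equiv> B [^]\<^bsub>bidual_algebra A\<^esub> (k :: nat)"

text \<open>Powers are products with a new factor on the right, and the right factor of an Arens product acts on
the functional. So a power is evaluated by letting \<open>B\<close> act repeatedly on \<open>l\<close> and evaluating the result
at the identity.\<close>

lemma power_BD_0: "l \<in> carrier D \<Longrightarrow> power_BD B 0 l = l (delta 0)"
  and power_BD_Suc: "l \<in> carrier D \<Longrightarrow> power_BD B (Suc k) l = power_BD B k (bidual_act A B l)"
  by (simp_all add: nat_pow_def bidual_algebra_simps arens_product_def)

end

context beurling_weight
begin

text \<open>The scaled point masses lie in the unit ball, so as functions on the dual they have a pointwise cluster
point, which inherits linearity and the norm bound.\<close>

lemma exists_limit_functional: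
  fixes p :: "nat \<Rightarrow> int" and c :: "nat \<Rightarrow> real"
  assumes c: "\<And>i. \<omega> (p i) \<le> c i"
  obtains \<Phi> G where "\<Phi> \<in> carrier BD" "G \<le> sequentially" "G \<noteq> bot"
    "\<And>l. l \<in> carrier D \<Longrightarrow> ((\<lambda>i. l (delta (p i)) / c i) \<longlongrightarrow> \<Phi> l) G"
proof -
  have c_pos: "c i > 0" for i using c[of i] \<omega>_pos(1)[of "p i"] by linarith
  define e where "e i l = (if l \<in> carrier D then l (delta (p i)) / c i else 0)" for i l
  have e_le: "cmod (e i l) \<le> \<bar>vnorm D l\<bar>" for i l
  proof (cases "l \<in> carrier D")
    case True
    then have "cmod (l (delta (p i))) \<le> vnorm D l * c i"
      using D_delta_bound[of l "p i"] mult_left_mono[OF c[of i] vnorm_D_nonneg[of l]] by linarith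
    then show ?thesis
      using True c_pos[of i] vnorm_D_nonneg[of l] by (simp add: e_def norm_divide divide_simps)
  qed (simp add: e_def)
  obtain G \<Phi> where G: "G \<le> sequentially" "G \<noteq> bot" and lim: "\<And>l. ((\<lambda>i. e i l) \<longlongrightarrow> \<Phi> l) G"
    using pointwise_convergent_subfilter[of e, OF e_le] by blast
  have "restrict \<Phi> (carrier D) \<in> carrier BD"
  proof (rule BDI)
    fix l l' assume l: "l \<in> carrier D" "l' \<in> carrier D"
    have "(\<lambda>i. e i (vadd D l l')) = (\<lambda>i. e i l + e i l')"
      using l by (simp add: e_def D_add_mem) (simp add: D_simps(2) add_divide_distrib)
    then have "\<Phi> (vadd D l l') = \<Phi> l + \<Phi> l'"
      using tendsto_unique[OF G(2) lim[of "vadd D l l'"]] tendsto_add[OF lim lim] by metis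
    then show "restrict \<Phi> (carrier D) (vadd D l l')
        = restrict \<Phi> (carrier D) l + restrict \<Phi> (carrier D) l'"
      using l by (simp add: D_add_mem)
  next
    fix a l assume l: "l \<in> carrier D"
    have "(\<lambda>i. e i (vscale D a l)) = (\<lambda>i. a * e i l)"
      using l by (simp add: e_def D_scale_mem) (simp add: D_simps(3))
    then have "\<Phi> (vscale D a l) = a * \<Phi> l"
      using tendsto_unique[OF G(2) lim[of "vscale D a l"]] tendsto_mult_left[OF lim] by metis
    then show "restrict \<Phi> (carrier D) (vscale D a l) = a * restrict \<Phi> (carrier D) l"
      using l by (simp add: D_scale_mem)
  next
    fix l assume l: "l \<in> carrier D"
    have "cmod (\<Phi> l) \<le> \<bar>vnorm D l\<bar>"
      by (rule Lim_norm_ubound[OF G(2) lim]) (simp add: e_le)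
    then show "cmod (restrict \<Phi> (carrier D) l) \<le> 1 * vnorm D l"
      using l vnorm_D_nonneg[of l] by simp
  qed simp
  moreover have "((\<lambda>i. l (delta (p i)) / c i) \<longlongrightarrow> restrict \<Phi> (carrier D) l) G" if "l \<in> carrier D" for l
    using lim[of l] that by (simp add: e_def)
  ultimately show ?thesis using that G by blast
qed

text \<open>The weight itself, viewed as a functional that is positive on point masses. It detects that the powers of
a limit of point masses do not vanish.\<close>

lemma weight_functional:
  obtains l where "l \<in> carrier D" "\<And>n. l (delta n) = of_real (\<omega> n)"
proof
  let ?l = "\<lambda>f \<in> carrier A. \<Sum>\<^sub>\<infinity>n. f n * complex_of_real (\<omega> n)"
  have abs: "(\<lambda>n. cmod (f n * complex_of_real (\<omega> n))) summable_on UNIV" if "f \<in> carrier A" for f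
    using that by (simp add: carrier_iff norm_mult abs_of_pos)
  show "?l \<in> carrier D"
  proof (rule DI)
    fix f assume f: "f \<in> carrier A"
    show "cmod (?l f) \<le> 1 * nrm A f"
      using norm_infsum_bound[OF abs[OF f]] f by (simp add: nrm_eq norm_mult abs_of_pos)
  next
    fix f g assume "f \<in> carrier A" "g \<in> carrier A"
    then show "?l (\<lambda>n. f n + g n) = ?l f + ?l g"
      using abs by (simp add: add_mem distrib_right infsum_add abs_summable_summable)
  next
    fix a f assume "f \<in> carrier A"
    then show "?l (\<lambda>n. a * f n) = a * ?l f"
      by (simp add: scale_mem mult.assoc infsum_cmult_right')
  qed simp
  fix n
  have "((\<lambda>k. delta n k * complex_of_real (\<omega> k)) has_sum complex_of_real (\<omega> n)) UNIV"
    by (rule has_sum_finite_neutralI[of "{n}"]) (auto simp: delta_def)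
  then show "?l (delta n) = of_real (\<omega> n)" by (simp add: infsumI)
qed

end

section \<open>Limits of scaled point masses\<close>

locale limit_functional = beurling_weight +
  fixes p :: "nat \<Rightarrow> int" and c :: "nat \<Rightarrow> real"
    and G :: "nat filter" and \<Phi> :: "((int \<Rightarrow> complex) \<Rightarrow> complex) \<Rightarrow> complex"
  assumes c_pos: "\<And>i. c i > 0"
    and \<Phi>_mem: "\<Phi> \<in> carrier BD" and G_le: "G \<le> sequentially" and G_nontrivial: "G \<noteq> bot"
    and \<Phi>_lim: "\<And>l. l \<in> carrier D \<Longrightarrow> ((\<lambda>i. l (delta (p i)) / c i) \<longlongrightarrow> \<Phi> l) G"
begin

lemma eventually_G: "eventually P sequentially \<Longrightarrow> eventually P G"
  using G_le by (rule filter_leD)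

lemma bidual_act_\<Phi>_lim:
  assumes "l \<in> carrier D"
  shows "((\<lambda>i. l (delta (m + p i)) / c i) \<longlongrightarrow> bidual_act A \<Phi> l (delta m)) G"
  using \<Phi>_lim[OF functional_act_mem[OF assms delta_mem], of m] by (simp add: delta_mult_delta)

lemma prod_c_pos: "prod_list (map c js) > 0"
  by (induction js) (auto simp: c_pos)

text \<open>The hypothesis on \<open>l\<close> is chosen to be inherited by the functional on which the remaining \<open>k\<close> factors act: one
factor \<open>\<Phi>\<close> replaces an index of the list by a limit, and one factor \<open>\<Psi>\<close> moves the base point \<open>m\<close>
by some \<open>r\<close>, where \<open>\<omega> (m + r) \<le> \<omega> m * \<omega> r\<close> lets the norm of \<open>\<Psi>\<close> absorb \<open>\<omega> r\<close>. Commutativity of \<open>\<int>\<close>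
enters in that all shifts are collected in a single base point.\<close>

lemma power_arens_bound:
  assumes \<Psi>: "\<Psi> \<in> carrier BD" "C \<ge> 0" "\<And>l. l \<in> carrier D \<Longrightarrow> cmod (\<Psi> l) \<le> C * vnorm D l"
    and "l \<in> carrier D" "d \<ge> 0"
    and "\<And>m js. length js = k \<Longrightarrow> (\<forall>j\<in>set js. K \<le> j) \<Longrightarrow>
      cmod (l (delta (m + sum_list (map p js)))) \<le> d * \<omega> m * prod_list (map c js)"
  shows "cmod (power_BD (arens_product A \<Psi> \<Phi>) k l) \<le> C ^ k * d"
  using assms(4-)
proof (induction k arbitrary: l d)
  case 0
  show ?case unfolding power_BD_0[OF 0(1)] using 0(3)[of "[]" 0] by (simp add: \<omega>_0)
next
  case (Suc k)
  let ?B = "arens_product A \<Psi> \<Phi>"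
  let ?l = "bidual_act A ?B l"
  have B: "?B \<in> carrier BD" using \<Psi>(1) \<Phi>_mem by (rule arens_mem)
  have "cmod (power_BD ?B k ?l) \<le> C ^ k * (C * d)"
  proof (rule Suc.IH)
    fix m js assume js: "length js = k" "\<forall>j\<in>set js. K \<le> j"
    define q where "q = m + sum_list (map p js)"
    define \<mu> where "\<mu> = bidual_act A \<Phi> (functional_act A l (delta q))"
    have \<mu>: "\<mu> \<in> carrier D" using Suc.prems(1) \<Phi>_mem by (simp add: \<mu>_def)
    have "cmod (\<mu> (delta r)) \<le> (d * \<omega> m * prod_list (map c js)) * \<omega> r" for r
    proof -
      have "((\<lambda>i. l (delta (q + r + p i)) / c i) \<longlongrightarrow> \<mu> (delta r)) G"
        using bidual_act_\<Phi>_lim[OF functional_act_mem[OF Suc.prems(1) delta_mem], of q r]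
        by (simp add: \<mu>_def delta_mult_delta add.assoc)
      moreover have "\<forall>\<^sub>F i in G. cmod (l (delta (q + r + p i)) / c i)
          \<le> (d * \<omega> m * prod_list (map c js)) * \<omega> r"
      proof (rule eventually_G, rule eventually_sequentiallyI)
        fix i assume "K \<le> i"
        then have "cmod (l (delta ((m + r) + sum_list (map p (i # js)))))
            \<le> d * \<omega> (m + r) * prod_list (map c (i # js))"
          using js by (intro Suc.prems(3)) auto
        also have "\<dots> \<le> d * (\<omega> m * \<omega> r) * prod_list (map c (i # js))"
          using Suc.prems(2) \<omega>_add prod_c_pos[of "i # js"]
          by (intro mult_right_mono mult_left_mono) (auto intro: less_imp_le)
        finally show "cmod (l (delta (q + r + p i)) / c i)
            \<le> (d * \<omega> m * prod_list (map c js)) * \<omega> r"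
          using c_pos[of i] by (simp add: q_def norm_divide field_simps)
      qed
      ultimately show ?thesis using G_nontrivial by (intro Lim_norm_ubound)
    qed
    then have "vnorm D \<mu> \<le> d * \<omega> m * prod_list (map c js)"
      by (rule vnorm_D_le_delta[OF \<mu>])
    then have "C * vnorm D \<mu> \<le> C * (d * \<omega> m * prod_list (map c js))"
      using \<Psi>(2) by (rule mult_left_mono)
    moreover have "?l (delta q) = \<Psi> \<mu>"
      using Suc.prems(1) by (simp add: arens_product_def \<mu>_def)
    ultimately show "cmod (?l (delta (m + sum_list (map p js)))) \<le> C * d * \<omega> m * prod_list (map c js)"
      using \<Psi>(3)[OF \<mu>] by (simp add: q_def mult.assoc)
  qed (use B Suc.prems \<Psi>(2) in auto)
  then show ?case unfolding power_BD_Suc[OF Suc.prems(1)] by (simp add: mult_ac)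
qed

text \<open>On the unit ball of the dual, submultiplicativity splits off \<open>\<omega> m\<close>, so \<open>power_arens_bound\<close> applies with
\<open>\<epsilon> k\<close> and gives the norm bound \<open>C ^ k * \<epsilon> k\<close>.\<close>

lemma in_jacobson_radical:
  assumes small: "\<And>k. \<exists>K. \<forall>js. length js = k \<longrightarrow> (\<forall>j\<in>set js. K \<le> j) \<longrightarrow>
      \<omega> (sum_list (map p js)) \<le> \<epsilon> k * prod_list (map c js)"
    and \<epsilon>: "(\<lambda>k. root k (\<epsilon> k)) \<longlonglongrightarrow> 0"
  shows "\<Phi> \<in> jacobson_radical (bidual_algebra A)"
  unfolding jacobson_radical_def bidual_algebra_simps(1,2)
proof (rule CollectI, rule conjI, rule \<Phi>_mem, rule ballI)
  fix \<Psi> assume \<Psi>: "\<Psi> \<in> carrier BD"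
  obtain C where C: "C \<ge> 0" "\<And>l. l \<in> carrier D \<Longrightarrow> cmod (\<Psi> l) \<le> C * vnorm D l"
    by (rule BD_bound[OF \<Psi>], rule that)
  let ?P = "\<lambda>k. power_BD (arens_product A \<Psi> \<Phi>) k"
  have bound: "0 \<le> vnorm BD (?P k) \<and> vnorm BD (?P k) \<le> C ^ k * \<epsilon> k" for k
  proof -
    from small[of k] obtain K where "\<forall>js. length js = k \<longrightarrow> (\<forall>j\<in>set js. K \<le> j) \<longrightarrow>
      \<omega> (sum_list (map p js)) \<le> \<epsilon> k * prod_list (map c js)" ..
    note K = this[rule_format]
    \<comment> \<open>Weights are positive, so the hypothesis at any single list forces \<open>\<epsilon> k\<close> to be positive.\<close>
    have "0 < \<epsilon> k * prod_list (map c (replicate k K))"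
      by (rule less_le_trans[OF \<omega>_pos(1) K]) auto
    then have \<epsilon>_pos: "\<epsilon> k > 0" by (rule zero_less_mult_pos2[OF _ prod_c_pos])
    have le: "cmod (?P k l) \<le> C ^ k * \<epsilon> k" if l: "l \<in> carrier D" "vnorm D l \<le> 1" for l
    proof (rule power_arens_bound[OF \<Psi> C l(1)])
      fix m and js :: "nat list" assume js: "length js = k" "\<forall>j\<in>set js. K \<le> j"
      let ?s = "sum_list (map p js)"
      have "cmod (l (delta (m + ?s))) \<le> vnorm D l * \<omega> (m + ?s)" by (rule D_delta_bound[OF l(1)])
      also have "\<dots> \<le> 1 * \<omega> (m + ?s)" using l(2) by (intro mult_right_mono) auto
      also have "\<dots> \<le> \<omega> m * \<omega> ?s" using \<omega>_add by simp
      also have "\<dots> \<le> \<omega> m * (\<epsilon> k * prod_list (map c js))" using K[OF js(1)] js(2) by (intro mult_left_mono) auto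
      finally show "cmod (l (delta (m + ?s))) \<le> \<epsilon> k * \<omega> m * prod_list (map c js)"
        by (simp add: mult_ac)
    qed (use \<epsilon>_pos in auto)
    have zero: "(\<lambda>f \<in> carrier A. 0) \<in> carrier D" "vnorm D (\<lambda>f \<in> carrier A. 0) \<le> 1"
      using zero_D vnorm_D_zero by auto
    have ball: "\<exists>l\<in>carrier D. vnorm D l \<le> 1" by (rule bexI) (rule zero)+
    have "vnorm BD (?P k) \<le> C ^ k * \<epsilon> k"
      by (rule vnorm_dual_le[OF le ball])
    moreover have "0 \<le> vnorm BD (?P k)"
      by (rule order_trans[OF norm_ge_zero le_vnorm_dual[OF le zero]])
    ultimately show ?thesis by simp
  qed
  have "(\<lambda>k. root k (vnorm BD (?P k))) \<longlonglongrightarrow> 0"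
  proof (rule tendsto_sandwich[OF _ _ tendsto_const])
    show "\<forall>\<^sub>F k in sequentially. 0 \<le> root k (vnorm BD (?P k))"
      using bound by (auto intro!: always_eventually real_root_ge_zero)
    show "\<forall>\<^sub>F k in sequentially. root k (vnorm BD (?P k)) \<le> C * root k (\<epsilon> k)"
    proof (rule eventually_sequentiallyI)
      fix k :: nat assume "1 \<le> k"
      then have "root k (vnorm BD (?P k)) \<le> root k (C ^ k * \<epsilon> k)" using bound by simp
      also have "\<dots> = C * root k (\<epsilon> k)"
        using \<open>1 \<le> k\<close> C(1) by (simp add: real_root_mult real_root_power_cancel)
      finally show "root k (vnorm BD (?P k)) \<le> C * root k (\<epsilon> k)" .
    qed
    show "(\<lambda>k. C * root k (\<epsilon> k)) \<longlonglongrightarrow> 0" using tendsto_mult_left[OF \<epsilon>, of C] by simp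
  qed
  then show "quasi_nilpotent (bidual_algebra A) (arens_product A \<Psi> \<Phi>)"
    by (simp add: quasi_nilpotent_def bidual_algebra_simps(5))
qed

text \<open>In the iterated limit, each new index may be assumed to exceed all previous ones, so a lower bound for
lists of distinct indices is enough.\<close>

lemma power_\<Phi>_lower_bound:
  assumes "l \<in> carrier D"
    and "\<And>js. distinct js \<Longrightarrow> length js = k \<Longrightarrow> (\<forall>j\<in>set js. K \<le> j) \<Longrightarrow>
      e * prod_list (map c js) \<le> Re (l (delta (sum_list (map p js))))"
  shows "e \<le> Re (power_BD \<Phi> k l)"
  using assms
proof (induction k arbitrary: l)
  case 0
  show ?case unfolding power_BD_0[OF 0(1)] using 0(2)[of "[]"] by simp
next
  case (Suc k)
  have "e \<le> Re (power_BD \<Phi> k (bidual_act A \<Phi> l))"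
  proof (rule Suc.IH)
    fix js assume js: "distinct js" "length js = k" "\<forall>j\<in>set js. K \<le> j"
    let ?s = "sum_list (map p js)"
    have "((\<lambda>i. Re (l (delta (?s + p i)) / c i)) \<longlongrightarrow> Re (bidual_act A \<Phi> l (delta ?s))) G"
      by (intro tendsto_Re bidual_act_\<Phi>_lim Suc.prems(1))
    moreover have "\<forall>\<^sub>F i in G. e * prod_list (map c js) \<le> Re (l (delta (?s + p i)) / c i)"
    proof (rule eventually_G, rule eventually_sequentiallyI)
      \<comment> \<open>The sum of the previous indices bounds each of them.\<close>
      fix i assume i: "K + Suc (sum_list js) \<le> i"
      then have "i \<notin> set js" using member_le_sum_list[of i js] by auto
      then have "e * prod_list (map c (i # js)) \<le> Re (l (delta (sum_list (map p (i # js)))))"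
        using js i by (intro Suc.prems(2)) auto
      then show "e * prod_list (map c js) \<le> Re (l (delta (?s + p i)) / c i)"
        using c_pos[of i] by (simp add: field_simps)
    qed
    ultimately show "e * prod_list (map c js) \<le> Re (bidual_act A \<Phi> l (delta ?s))"
      using G_nontrivial by (intro tendsto_lowerbound)
  qed (use Suc.prems(1) \<Phi>_mem in simp)
  then show ?case unfolding power_BD_Suc[OF Suc.prems(1)] .
qed

lemma not_nilpotent:
  assumes large: "\<And>k. \<exists>e>0. \<exists>K. \<forall>js. distinct js \<longrightarrow> length js = k \<longrightarrow> (\<forall>j\<in>set js. K \<le> j) \<longrightarrow>
      e * prod_list (map c js) \<le> \<omega> (sum_list (map p js))"
  shows "\<not> nilpotent (bidual_algebra A) \<Phi>"
proof
  assume "nilpotent (bidual_algebra A) \<Phi>"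
  then obtain k where k: "power_BD \<Phi> k = (\<lambda>l \<in> carrier D. 0)"
    by (auto simp: nilpotent_def bidual_algebra_simps(4))
  obtain l where l: "l \<in> carrier D" "\<And>n. l (delta n) = of_real (\<omega> n)"
    using weight_functional by blast
  obtain e K where "e > 0" and e: "\<And>js. distinct js \<Longrightarrow> length js = k \<Longrightarrow> \<forall>j\<in>set js. K \<le> j \<Longrightarrow>
      e * prod_list (map c js) \<le> \<omega> (sum_list (map p js))"
    using large[of k] by blast
  have "e \<le> Re (power_BD \<Phi> k l)"
    by (rule power_\<Phi>_lower_bound[OF l(1), of k K]) (simp add: l(2) e)
  then show False using k l(1) \<open>e > 0\<close> by simp
qed

end

section \<open>The example\<close>

interpretation wt: beurling_weight wt
  by standard (simp add: weight_def wt_ge_1 wt_mult, simp add: wt_def len_0)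

text \<open>Generators are numbered from \<open>1\<close>, but sequences from \<open>0\<close>; hence the shift by \<open>Suc\<close> in what follows.\<close>

lemma sum_gen_Suc:
  "sum_list (map (\<lambda>i. int (gen (Suc i))) js) = int (sum_list (map gen (map Suc js)))"
  by (induction js) auto

lemma prod_4_Suc:
  "prod_list (map (\<lambda>i. 4 ^ Suc i) js) = (2::real) ^ (2 * sum_list (map Suc js))"
  by (induction js) (auto simp: power_add power_mult)

lemma wt_sum_gen_le:
  assumes "\<forall>j\<in>set js. length js \<le> j"
  shows "wt (sum_list (map (\<lambda>i. int (gen (Suc i))) js))
    \<le> (1 / 2) ^ (\<Sum>s=1..length js. length js - s) * prod_list (map (\<lambda>i. 4 ^ Suc i) js)"
proof -
  let ?t = "\<Sum>s=1..length js. length js - s"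
  let ?js = "map Suc js"
  have "len (int (sum_list (map gen ?js))) + ?t \<le> 2 * sum_list ?js"
    using assms len_sum_gen_le[of ?js] by (force simp del: map_map)
  then have "(2::real) ^ (len (int (sum_list (map gen ?js))) + ?t) \<le> 2 ^ (2 * sum_list ?js)"
    by (intro power_increasing) auto
  then show ?thesis
    unfolding sum_gen_Suc prod_4_Suc wt_def by (simp add: power_add power_divide field_simps)
qed

lemma wt_sum_gen_ge:
  assumes "distinct js"
  shows "(1 / 2) ^ (2 * (length js)\<^sup>2) * prod_list (map (\<lambda>i. 4 ^ Suc i) js)
    \<le> wt (sum_list (map (\<lambda>i. int (gen (Suc i))) js))"
proof -
  let ?js = "map Suc js"
  have "2 * sum_list ?js \<le> len (int (sum_list (map gen ?js))) + 2 * (length js)\<^sup>2"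
    using len_sum_gen_ge[of ?js] assms by (simp add: distinct_map)
  then have "(2::real) ^ (2 * sum_list ?js) \<le> 2 ^ (len (int (sum_list (map gen ?js))) + 2 * (length js)\<^sup>2)"
    by (intro power_increasing) auto
  then show ?thesis
    unfolding sum_gen_Suc prod_4_Suc wt_def by (simp add: power_add power_divide field_simps)
qed

text \<open>The exponent is the triangular number \<open>k (k - 1) / 2\<close>, so that the \<open>k\<close>-th root is \<open>(1 / 2) powr ((k - 1) / 2)\<close>.\<close>

lemma root_triangular_tendsto_0:
  "(\<lambda>k. root k ((1 / 2) ^ (\<Sum>s=1..k. k - s))) \<longlonglongrightarrow> 0"
proof (rule LIMSEQ_imp_Suc)
  have "root (Suc k) ((1 / 2) ^ (\<Sum>s=1..Suc k. Suc k - s)) = sqrt (1 / 2) ^ k" for k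
  proof -
    have tri: "2 * (\<Sum>s=1..n. n - s) = n * (n - 1)" for n :: nat
    proof -
      have "(\<Sum>s=1..n. n - s) = (\<Sum>s<n. s)"
        by (rule sum.reindex_bij_witness[of _ "\<lambda>s. n - s" "\<lambda>s. n - s"]) auto
      moreover have "2 * (\<Sum>s<n. s) = n * (n - 1)"
      proof (induction n)
        case (Suc n)
        then show ?case by (cases n) (auto simp: algebra_simps)
      qed simp
      ultimately show ?thesis by simp
    qed
    have "((1::real) / 2) ^ (\<Sum>s=1..Suc k. Suc k - s) = sqrt (1 / 2) ^ (2 * (\<Sum>s=1..Suc k. Suc k - s))"
      by (simp add: power_mult)
    also have "\<dots> = (sqrt (1 / 2) ^ k) ^ Suc k"
      by (simp only: tri power_mult[symmetric]) (simp add: mult.commute)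
    finally show ?thesis
      by (simp only:) (rule real_root_power_cancel, auto)
  qed
  moreover have "(\<lambda>k. sqrt (1 / 2) ^ k) \<longlonglongrightarrow> 0"
    by (rule LIMSEQ_power_zero) (simp add: real_sqrt_divide)
  ultimately show "(\<lambda>k. root (Suc k) ((1 / 2) ^ (\<Sum>s=1..Suc k. Suc k - s))) \<longlonglongrightarrow> 0" by simp
qed

theorem theorem1p3:
  "\<exists>\<omega>. weight \<omega> \<and>
    (\<exists>\<Phi> \<in> jacobson_radical (bidual_algebra (beurling \<omega>)).
      \<not> nilpotent (bidual_algebra (beurling \<omega>)) \<Phi>)"
proof -
  let ?p = "\<lambda>i. int (gen (Suc i))" and ?c = "\<lambda>i. (4::real) ^ Suc i"
  have "wt (?p i) \<le> ?c i" for i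
  proof -
    have "len (?p i) \<le> 2 * Suc i" using len_sum_gen_le[of "[Suc i]"] by simp
    then have "wt (?p i) \<le> 2 ^ (2 * Suc i)" unfolding wt_def by (intro power_increasing) auto
    then show ?thesis by (simp only: power_mult) simp
  qed
  then obtain \<Phi> G where \<Phi>: "\<Phi> \<in> carrier wt.BD" "G \<le> sequentially" "G \<noteq> bot"
    "\<And>l. l \<in> carrier wt.D \<Longrightarrow> ((\<lambda>i. l (delta (?p i)) / ?c i) \<longlongrightarrow> \<Phi> l) G"
    using wt.exists_limit_functional[of ?p ?c] by blast
  interpret limit_functional wt ?p ?c G \<Phi>
    by standard (use \<Phi> in auto)
  have "\<Phi> \<in> jacobson_radical (bidual_algebra (beurling wt))"
  proof (rule in_jacobson_radical[OF _ root_triangular_tendsto_0])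
    show "\<exists>K. \<forall>js. length js = k \<longrightarrow> (\<forall>j\<in>set js. K \<le> j) \<longrightarrow>
        wt (sum_list (map ?p js)) \<le> (1 / 2) ^ (\<Sum>s=1..k. k - s) * prod_list (map ?c js)" for k
      using wt_sum_gen_le by (intro exI[of _ k]) blast
  qed
  moreover have "\<not> nilpotent (bidual_algebra (beurling wt)) \<Phi>"
  proof (rule not_nilpotent)
    show "\<exists>e>0. \<exists>K. \<forall>js. distinct js \<longrightarrow> length js = k \<longrightarrow> (\<forall>j\<in>set js. K \<le> j) \<longrightarrow>
        e * prod_list (map ?c js) \<le> wt (sum_list (map ?p js))" for k
      using wt_sum_gen_ge by (intro exI[of _ "(1 / 2) ^ (2 * k\<^sup>2)"]) auto
  qed
  ultimately show ?thesis using wt.weight by blast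
qed

end
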